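(* Let $\mathbb{K}$ be a field, $S=\mathbb{K}[x_1,\dots,x_n]$, and let $I\subsetneq S$ be a weakly polymatroidal monomial ideal. Then $\operatorname{depth}(S/I)\leq \operatorname{sdepth}(S/I)$, i.e. $S/I$ satisfies Stanley's conjecture.
   Context: For a monomial ideal $I$ let $G(I)$ be its set of minimal monomial generators. $I$ is called weakly polymatroidal if for every two monomials $u=x_1^{a_1}\cdots x_n^{a_n}$ and $v=x_1^{b_1}\cdots x_n^{b_n}$ in $G(I)$ such that $a_1=b_1,\dots,a_{t-1}=b_{t-1}$ and $a_t>b_t$ for some $t$, there exists $j>t$ such that $x_t(v/x_j)\in I$. For a finitely generated $\mathbb{Z}^n$-graded $S$-module $M$: a Stanley space is a $\mathbb{K}$-subspace $u\mathbb{K}[Z]$, with $u\in M$ homogeneous and $Z\subseteq\{x_1,\dots,x_n\}$, which is a free $\mathbb{K}[Z]$-module, of dimension $|Z|$; a Stanley decomposition of $M$ is a decomposition of $M$ as a finite direct sum of Stanley spaces (as $\mathbb{K}$-vector spaces); its Stanley depth is the minimum dimension of its Stanley spaces; $\operatorname{sdepth}(M)$ is the maximum Stanley depth over all Stanley decompositions of $M$. *)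

theory Defs
  imports Main "HOL-Library.Poly_Mapping"
begin

text \<open>Polynomial ring S = K[x_v : v in 'v] over a field 'k, with a finite linearly
ordered set of variables 'v (so x_1 < ... < x_n, n = CARD('v)).  Monomials are
exponent vectors 'v =>0 nat; polynomials are finitely supported maps from
monomials to coefficients.\<close>

type_synonym ('v, 'k) mpoly = "('v \<Rightarrow>\<^sub>0 nat) \<Rightarrow>\<^sub>0 'k"

definition mon :: "('v \<Rightarrow>\<^sub>0 nat) \<Rightarrow> ('v, 'k::comm_ring_1) mpoly" where
  "mon a = Poly_Mapping.single a 1"

definition ideal_gen :: "('v, 'k::comm_ring_1) mpoly set \<Rightarrow> ('v, 'k) mpoly set" where
  "ideal_gen G = {(\<Sum>g\<in>F. c g * g) | F c. finite F \<and> F \<subseteq> G}"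

definition is_ideal :: "('v, 'k::comm_ring_1) mpoly set \<Rightarrow> bool" where
  "is_ideal I \<longleftrightarrow> 0 \<in> I \<and> (\<forall>f\<in>I. \<forall>g\<in>I. f + g \<in> I) \<and> (\<forall>f\<in>I. \<forall>h. h * f \<in> I)"

definition monomial_ideal :: "('v, 'k::comm_ring_1) mpoly set \<Rightarrow> bool" where
  "monomial_ideal I \<longleftrightarrow> (\<exists>A. I = ideal_gen (mon ` A))"

definition mdvd :: "('v \<Rightarrow>\<^sub>0 nat) \<Rightarrow> ('v \<Rightarrow>\<^sub>0 nat) \<Rightarrow> bool" where
  "mdvd a b \<longleftrightarrow> (\<forall>i. Poly_Mapping.lookup a i \<le> Poly_Mapping.lookup b i)"

definition min_gens :: "('v, 'k::comm_ring_1) mpoly set \<Rightarrow> ('v \<Rightarrow>\<^sub>0 nat) set" where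
  "min_gens I = {a. mon a \<in> I \<and> (\<forall>b. mon b \<in> I \<and> mdvd b a \<longrightarrow> b = a)}"

text \<open>Weakly polymatroidal (with respect to the order x_1 < ... < x_n of the variables).
  x_t (v / x_j) is the monomial with exponent b + e_t - e_j, where x_j divides v.\<close>
definition weakly_polymatroidal :: "('v::linorder, 'k::comm_ring_1) mpoly set \<Rightarrow> bool" where
  "weakly_polymatroidal I \<longleftrightarrow>
     (\<forall>a\<in>min_gens I. \<forall>b\<in>min_gens I. \<forall>t.
        (\<forall>i<t. Poly_Mapping.lookup a i = Poly_Mapping.lookup b i) \<and> Poly_Mapping.lookup a t > Poly_Mapping.lookup b t \<longrightarrow>
        (\<exists>j>t. Poly_Mapping.lookup b j > 0 \<and>
            mon (b + Poly_Mapping.single t 1 - Poly_Mapping.single j 1) \<in> I))"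

definition max_ideal :: "('v, 'k::comm_ring_1) mpoly set" where
  "max_ideal = {f. Poly_Mapping.lookup f 0 = 0}"

definition regular_seq :: "('v, 'k::comm_ring_1) mpoly set \<Rightarrow> ('v, 'k) mpoly list \<Rightarrow> bool" where
  "regular_seq I fs \<longleftrightarrow> set fs \<subseteq> max_ideal \<and>
     (\<forall>i<length fs. \<forall>g. fs ! i * g \<in> ideal_gen (I \<union> set (take i fs)) \<longrightarrow>
                          g \<in> ideal_gen (I \<union> set (take i fs))) \<and>
     1 \<notin> ideal_gen (I \<union> set fs)"

definition depth_quot :: "('v, 'k::comm_ring_1) mpoly set \<Rightarrow> nat" where
  "depth_quot I = Sup {length fs | fs. regular_seq I fs}"

text \<open>Stanley decompositions of S/I.  A Stanley space u K[Z] is given by a nonzero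
  homogeneous (i.e. Z^n-graded) element of S/I, represented by a term c x^a, and a set
  Z of variables; K[Z] is the subring of polynomials in the variables of Z.\<close>
definition poly_in :: "'v set \<Rightarrow> ('v, 'k::comm_ring_1) mpoly set" where
  "poly_in Z = {f. \<forall>a\<in>Poly_Mapping.keys f. Poly_Mapping.keys a \<subseteq> Z}"

definition is_term :: "('v, 'k::comm_ring_1) mpoly \<Rightarrow> bool" where
  "is_term u \<longleftrightarrow> (\<exists>a c. u = Poly_Mapping.single a c)"

text \<open>u K[Z] (as a subspace of S/I) is a free K[Z]-module (on the basis u).\<close>
definition stanley_space :: "('v, 'k::comm_ring_1) mpoly set \<Rightarrow> ('v, 'k) mpoly \<Rightarrow> 'v set \<Rightarrow> bool" where
  "stanley_space I u Z \<longleftrightarrow> is_term u \<and> (\<forall>f\<in>poly_in Z. u * f \<in> I \<longrightarrow> f = 0)"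

text \<open>A finite list D of Stanley spaces (u_i, Z_i) is a Stanley decomposition of S/I if
  S/I is the direct sum (as K-vector spaces) of the subspaces u_i K[Z_i] + I.\<close>
definition stanley_decomp :: "('v, 'k::comm_ring_1) mpoly set \<Rightarrow> (('v, 'k) mpoly \<times> 'v set) list \<Rightarrow> bool" where
  "stanley_decomp I D \<longleftrightarrow>
     (\<forall>(u, Z)\<in>set D. stanley_space I u Z) \<and>
     (\<forall>g. \<exists>fs. length fs = length D \<and> (\<forall>i<length D. fs ! i \<in> poly_in (snd (D ! i))) \<and>
            g - (\<Sum>i<length D. fst (D ! i) * fs ! i) \<in> I) \<and>
     (\<forall>fs. length fs = length D \<and> (\<forall>i<length D. fs ! i \<in> poly_in (snd (D ! i))) \<and>
            (\<Sum>i<length D. fst (D ! i) * fs ! i) \<in> I \<longrightarrow>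
            (\<forall>i<length D. fst (D ! i) * fs ! i \<in> I))"

definition stanley_depth_of :: "(('v, 'k::comm_ring_1) mpoly \<times> 'v set) list \<Rightarrow> nat" where
  "stanley_depth_of D = Min ((\<lambda>(u, Z). card Z) ` set D)"

definition sdepth_quot :: "('v::finite, 'k::comm_ring_1) mpoly set \<Rightarrow> nat" where
  "sdepth_quot I = Sup {stanley_depth_of D | D. stanley_decomp I D}"

end

theory Submission
  imports Defs HOL.Modules
begin

text \<open>Let U be the set of exponents of the monomials of I, n the number of variables, and slice U
  by the exponent k of the first variable.  Weak polymatroidality passes to the slices U_k;
  moreover there is a d such that U_k is contained in m U_{k+1} for k < d and U_k = U_d for
  k \<ge> d.  It follows by induction on the number of variables that the inclusion of m I into I
  is zero on Koszul homology, and therefore that nonzero Koszul homology of U_d in homological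
  degree s, or of U_k (k < d) in degree s - 1, gives nonzero Koszul homology of I in degree s.

  Let s be least such that the Koszul homology of I vanishes in all degrees from s on.
  Recursion on the slices partitions the standard monomials into cones of dimension at least n - s.
  On the other hand S/I has nonzero Koszul homology in degree at least s, and dividing by a regular
  element raises the degree of a nonzero class by one, so a regular sequence has length at most
  n - s.\<close>

section \<open>Koszul differentials\<close>

text \<open>By the Auslander-Buchsbaum formula s is the projective dimension of S/I and n - s its
  depth; only the bound of the depth by n - s is used, and the argument with regular sequences gives
  it directly.

  In general, vanishing of Koszul homology does not pass to slices: in degree k of the first
  variable the Koszul complex of I is the mapping cone of the inclusion of U_(k-1) into U_k, so
  classes of the two slices may cancel. For k \<le> d the inclusion factors through m U_k and is
  zero on homology, so nothing cancels. This is why the statement about m I is the one to be proved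
  by induction.

  The two homological degrees match the dimension count: a cone over U_d gains the direction of the
  first variable, a cone over U_k with k < d does not and has to start with one dimension
  more.\<close>

definition sgn_ins :: "'v::linorder \<Rightarrow> 'v set \<Rightarrow> 'r::comm_ring_1" where
  "sgn_ins j A = (-1) ^ card {k\<in>A. k < j}"

text \<open>A chain is a function on all index sets at once, \<open>c A\<close> being its
  coefficient at e_A, so the differential at A collects the contributions of the sets
  \<open>insert j A\<close>. The sign is that of moving e_j to its sorted place in e_A.\<close>

definition kd :: "('v::{finite,linorder} \<Rightarrow> 'r::comm_ring_1) \<Rightarrow> ('v set \<Rightarrow> 'r) \<Rightarrow> 'v set \<Rightarrow> 'r" where
  "kd x c A = (\<Sum>j\<in>-A. sgn_ins j A * x j * c (insert j A))"

definition wedge :: "('v::{finite,linorder} \<Rightarrow> 'r::comm_ring_1) \<Rightarrow> ('v set \<Rightarrow> 'r) \<Rightarrow> 'v set \<Rightarrow> 'r" where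
  "wedge f c A = (\<Sum>j\<in>A. sgn_ins j (A - {j}) * f j * c (A - {j}))"

lemma sgn_ins_square: "sgn_ins j A * sgn_ins j A = 1"
  by (simp add: sgn_ins_def flip: power_mult_distrib)

lemma sgn_ins_insert:
  fixes j k :: "'v::{finite,linorder}"
  assumes "j \<notin> A"
  shows "sgn_ins k (insert j A) = (if j < k then - sgn_ins k A else sgn_ins k A)"
proof -
  have "{i \<in> insert j A. i < k} = (if j < k then insert j {i\<in>A. i < k} else {i\<in>A. i < k})"
    by auto
  then show ?thesis using assms by (simp add: sgn_ins_def)
qed

lemma sgn_ins_swap:
  fixes j k :: "'v::{finite,linorder}"
  assumes "j \<notin> A" "k \<notin> A" "j \<noteq> k"
  shows "sgn_ins j A * sgn_ins k (insert j A) = - (sgn_ins k A * sgn_ins j (insert k A))"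
  using assms by (auto simp: sgn_ins_insert)

lemma sgn_ins_exchange:
  fixes j k :: "'v::{finite,linorder}"
  assumes "j \<notin> A" "k \<notin> A" "j \<noteq> k"
  shows "sgn_ins k (insert j A) * sgn_ins j (insert k A) = - (sgn_ins j A * sgn_ins k A)"
  using assms by (auto simp: sgn_ins_insert)

lemma kd_add: "kd x (\<lambda>A. c A + d A) A = kd x c A + kd x d A"
  by (simp add: kd_def sum.distrib algebra_simps)

lemma kd_scale: "kd x (\<lambda>A. r * c A) A = r * kd x c A"
  by (simp add: kd_def sum_distrib_left algebra_simps)

lemma kd_minus: "kd x (\<lambda>A. - c A) A = - kd x c A"
  using kd_scale[of x "-1" c A] by simp

lemma kd_diff: "kd x (\<lambda>A. c A - d A) A = kd x c A - kd x d A"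
  using kd_add[of x c "\<lambda>A. - d A" A] kd_minus[of x d A] by simp

lemma kd_zero [simp]: "kd x (\<lambda>A. 0) A = 0"
  by (simp add: kd_def)

text \<open>The pairs (j,k) and (k,j) lead to the same set with opposite signs, so the two halves of
  the double sum cancel.\<close>

lemma kd_kd:
  fixes x :: "'v::{finite,linorder} \<Rightarrow> 'r::comm_ring_1"
  shows "kd x (kd x c) A = 0"
proof -
  define g where "g j k = sgn_ins j A * sgn_ins k (insert j A) * (x j * x k * c (insert k (insert j A)))" for j k
  define P where "P = {(j,k). j \<notin> A \<and> k \<notin> A \<and> j < k}"
  define Q where "Q = {(j,k). j \<notin> A \<and> k \<notin> A \<and> k < j}"
  have "kd x (kd x c) A = (\<Sum>j\<in>-A. \<Sum>k\<in>-insert j A. g j k)"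
    by (simp add: kd_def g_def sum_distrib_left mult_ac)
  also have "\<dots> = (\<Sum>(j,k)\<in>Sigma (-A) (\<lambda>j. -insert j A). g j k)"
    by (simp add: sum.Sigma)
  also have "Sigma (-A) (\<lambda>j. -insert j A) = P \<union> Q"
    by (auto simp: P_def Q_def)
  also have "(\<Sum>(j,k)\<in>P \<union> Q. g j k) = (\<Sum>(j,k)\<in>P. g j k) + (\<Sum>(j,k)\<in>Q. g j k)"
    by (rule sum.union_disjoint) (auto simp: P_def Q_def)
  also have "(\<Sum>(j,k)\<in>Q. g j k) = (\<Sum>(j,k)\<in>P. g k j)"
    by (rule sum.reindex_bij_witness[of _ prod.swap prod.swap]) (auto simp: P_def Q_def)
  also have "\<dots> = (\<Sum>(j,k)\<in>P. - g j k)"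
  proof (rule sum.cong[OF refl], clarify)
    fix j k assume "(j, k) \<in> P"
    then have "sgn_ins k A * sgn_ins j (insert k A) = - (sgn_ins j A * sgn_ins k (insert j A) :: 'r)"
      by (intro sgn_ins_swap) (auto simp: P_def)
    then show "g k j = - g j k"
      by (simp add: g_def insert_commute mult.commute)
  qed
  finally show ?thesis by (simp add: sum_negf case_prod_beta)
qed

text \<open>Wedging with f is a homotopy between zero and multiplication by f.x. Terms exchanging j
  in A for k outside A cancel by \<open>sgn_ins_exchange\<close>; those adding and removing the same
  index give f.x times z. Division by a regular element and the connecting map both rest on
  this.\<close>

lemma kd_wedge:
  fixes x :: "'v::{finite,linorder} \<Rightarrow> 'r::comm_ring_1"
  shows "kd x (wedge f z) A + wedge f (kd x z) A = (\<Sum>j\<in>UNIV. f j * x j) * z A"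
proof -
  define h where "h k j = sgn_ins j (A - {j}) * sgn_ins k (A - {j}) * (f j * z (insert k (A - {j})))" for k j
  define g where "g k j = x k * h k j" for k j
  have kw: "kd x (wedge f z) A = (\<Sum>k\<in>-A. f k * x k * z A - (\<Sum>j\<in>A. g k j))"
    unfolding kd_def
  proof (rule sum.cong[OF refl])
    fix k assume k: "k \<in> - A"
    have "(\<Sum>j\<in>A. sgn_ins j (insert k A - {j}) * f j * z (insert k A - {j}))
      = (\<Sum>j\<in>A. - (sgn_ins k A * h k j))"
    proof (rule sum.cong[OF refl])
      fix j assume j: "j \<in> A"
      then have ne: "j \<noteq> k" using k by auto
      have e: "insert k A - {j} = insert k (A - {j})" "insert j (A - {j}) = A" using j ne by auto
      have "sgn_ins k A * sgn_ins j (insert k (A - {j})) = - (sgn_ins j (A - {j}) * sgn_ins k (A - {j}) :: 'r)"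
        using sgn_ins_exchange[of j "A - {j}" k] k ne e by simp
      then have "sgn_ins k A * (sgn_ins k A * sgn_ins j (insert k (A - {j})))
          = sgn_ins k A * - (sgn_ins j (A - {j}) * sgn_ins k (A - {j}) :: 'r)"
        by simp
      then have "sgn_ins j (insert k (A - {j})) = - (sgn_ins k A * (sgn_ins j (A - {j}) * sgn_ins k (A - {j}) :: 'r))"
        by (simp add: sgn_ins_square flip: mult.assoc)
      then show "sgn_ins j (insert k A - {j}) * f j * z (insert k A - {j}) = - (sgn_ins k A * h k j)"
        by (simp add: e h_def mult_ac)
    qed
    then have w: "wedge f z (insert k A) = sgn_ins k A * f k * z A - sgn_ins k A * (\<Sum>j\<in>A. h k j)"
      using k by (simp add: wedge_def sum_negf sum_distrib_left)
    have "sgn_ins k A * x k * wedge f z (insert k A)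
      = (sgn_ins k A * sgn_ins k A) * (f k * x k * z A) - (sgn_ins k A * sgn_ins k A) * (\<Sum>j\<in>A. g k j)"
      unfolding w by (simp add: g_def algebra_simps sum_distrib_left)
    then show "sgn_ins k A * x k * wedge f z (insert k A) = f k * x k * z A - (\<Sum>j\<in>A. g k j)"
      by (simp add: sgn_ins_square)
  qed
  have wk: "wedge f (kd x z) A = (\<Sum>j\<in>A. f j * x j * z A + (\<Sum>k\<in>-A. g k j))"
    unfolding wedge_def
  proof (rule sum.cong[OF refl])
    fix j assume j: "j \<in> A"
    have e: "- (A - {j}) = insert j (-A)" "insert j (A - {j}) = A" using j by auto
    have "kd x z (A - {j}) = sgn_ins j (A - {j}) * x j * z A
        + (\<Sum>k\<in>-A. sgn_ins k (A - {j}) * x k * z (insert k (A - {j})))"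
      using j unfolding kd_def e by (subst sum.insert) (auto simp: insert_absorb)
    then have "sgn_ins j (A - {j}) * f j * kd x z (A - {j})
        = (sgn_ins j (A - {j}) * sgn_ins j (A - {j})) * (f j * x j * z A) + (\<Sum>k\<in>-A. g k j)"
      by (simp add: g_def h_def algebra_simps sum_distrib_left)
    then show "sgn_ins j (A - {j}) * f j * kd x z (A - {j}) = f j * x j * z A + (\<Sum>k\<in>-A. g k j)"
      by (simp add: sgn_ins_square)
  qed
  have un: "(\<Sum>k\<in>-A. f k * x k * z A) + (\<Sum>k\<in>A. f k * x k * z A) = (\<Sum>j\<in>UNIV. f j * x j) * z A"
    unfolding sum_distrib_right
    by (subst sum.union_disjoint[symmetric]) (auto intro: sum.cong)
  have sw: "(\<Sum>k\<in>-A. \<Sum>j\<in>A. g k j) = (\<Sum>j\<in>A. \<Sum>k\<in>-A. g k j)"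
    by (rule sum.swap)
  show ?thesis
    unfolding kw wk un[symmetric] sum.distrib sum_subtractf sw by simp
qed

section \<open>Weakly polymatroidal up-sets and their slices\<close>

text \<open>Only coordinates in W are compared, so membership in U ignores all others. Slices thus
  remain sets of exponents over the full type while W shrinks in the inductions.\<close>

definition upset_on :: "'v set \<Rightarrow> ('v \<Rightarrow> nat) set \<Rightarrow> bool" where
  "upset_on W U \<longleftrightarrow> (\<forall>a b. a \<in> U \<longrightarrow> (\<forall>i\<in>W. a i \<le> b i) \<longrightarrow> b \<in> U)"

definition mingen :: "('v \<Rightarrow> nat) set \<Rightarrow> ('v \<Rightarrow> nat) set" where
  "mingen U = {a \<in> U. \<forall>b\<in>U. b \<le> a \<longrightarrow> b = a}"

definition wpoly :: "('v::linorder \<Rightarrow> nat) set \<Rightarrow> bool" where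
  "wpoly U \<longleftrightarrow> (\<forall>a\<in>mingen U. \<forall>b\<in>mingen U. \<forall>t. (\<forall>i<t. a i = b i) \<and> b t < a t \<longrightarrow>
     (\<exists>j>t. 0 < b j \<and> b(t := Suc (b t), j := b j - 1) \<in> U))"

definition mmul :: "'v set \<Rightarrow> ('v \<Rightarrow> nat) set \<Rightarrow> ('v \<Rightarrow> nat) set" where
  "mmul W U = {a. \<exists>j\<in>W. 0 < a j \<and> a(j := a j - 1) \<in> U}"

definition slice :: "'v \<Rightarrow> nat \<Rightarrow> ('v \<Rightarrow> nat) set \<Rightarrow> ('v \<Rightarrow> nat) set" where
  "slice t k U = {a. a(t := k) \<in> U}"

lemma upset_onD: "upset_on W U \<Longrightarrow> a \<in> U \<Longrightarrow> (\<And>i. i \<in> W \<Longrightarrow> a i \<le> b i) \<Longrightarrow> b \<in> U"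
  unfolding upset_on_def by blast

lemma slice_iff [simp]: "a \<in> slice t k U \<longleftrightarrow> a(t := k) \<in> U"
  by (simp add: slice_def)

lemma upset_on_slice:
  assumes "upset_on (insert t W) U"
  shows "upset_on W (slice t k U)"
  unfolding upset_on_def
proof (intro allI impI)
  fix a b assume "a \<in> slice t k U" "\<forall>i\<in>W. a i \<le> b i"
  then show "b \<in> slice t k U"
    by (auto intro: upset_onD[OF assms, of "a(t := k)" "b(t := k)"])
qed

lemma slice_mono:
  assumes "upset_on W U" "k \<le> l"
  shows "slice t k U \<subseteq> slice t l U"
proof
  fix a assume "a \<in> slice t k U"
  then show "a \<in> slice t l U"
    using assms(2) by (auto intro: upset_onD[OF assms(1), of "a(t := k)" "a(t := l)"])
qed

lemma mmul_subset: "upset_on W U \<Longrightarrow> mmul V U \<subseteq> U"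
proof
  fix a assume U: "upset_on W U" and "a \<in> mmul V U"
  then obtain j where "a(j := a j - 1) \<in> U" by (auto simp: mmul_def)
  then show "a \<in> U" by (rule upset_onD[OF U]) auto
qed

lemma mingen_below:
  fixes a :: "'v::finite \<Rightarrow> nat"
  assumes "a \<in> U"
  obtains g where "g \<in> mingen U" "g \<le> a"
proof -
  have "\<exists>g\<in>mingen U. g \<le> a" using assms
  proof (induction "\<Sum>i\<in>UNIV. a i" arbitrary: a rule: less_induct)
    case less
    show ?case
    proof (cases "a \<in> mingen U")
      case False
      then obtain b where b: "b \<in> U" "b \<le> a" "b \<noteq> a" using less.prems by (auto simp: mingen_def)
      then obtain i where "b i \<noteq> a i" by auto
      with b(2) have "(\<Sum>i\<in>UNIV. b i) < (\<Sum>i\<in>UNIV. a i)"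
        by (intro sum_strict_mono_ex1) (auto simp: le_fun_def order.strict_iff_order)
      then show ?thesis using less.hyps[OF _ b(1)] b(2) order.trans by blast
    qed auto
  qed
  then show thesis using that by blast
qed

lemma mingen_outside:
  assumes "upset_on W U" "a \<in> mingen U" "i \<notin> W"
  shows "a i = 0"
proof -
  have "a(i := 0) \<in> U"
    by (rule upset_onD[OF assms(1), of a]) (use assms(2,3) in \<open>auto simp: mingen_def\<close>)
  moreover have "a(i := 0) \<le> a" by (simp add: le_fun_def)
  ultimately have "a(i := 0) = a" using assms(2) by (auto simp: mingen_def)
  then show ?thesis by (metis fun_upd_same)
qed

lemma mingen_not_lower: "a \<in> mingen U \<Longrightarrow> 0 < a j \<Longrightarrow> a(j := a j - 1) \<notin> U"
  by (auto simp: mingen_def le_fun_def fun_eq_iff split: if_splits)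

text \<open>Minimal generators vanish outside \<open>insert t W\<close>, so any two of them agree
  before t and the exchange property applies at t itself.\<close>

lemma wpoly_first:
  fixes t :: "'v::{finite,linorder}"
  assumes "upset_on (insert t W) U" "wpoly U" "\<forall>w\<in>W. t < w"
    and g: "g \<in> mingen U" and h: "h \<in> mingen U" and lt: "h t < g t"
  obtains j where "j \<in> W" "0 < h j" "h(t := Suc (h t), j := h j - 1) \<in> U"
proof -
  have "g i = h i" if "i < t" for i
  proof -
    have "i \<notin> insert t W" using that assms(3) by auto
    then show ?thesis using mingen_outside[OF assms(1) g] mingen_outside[OF assms(1) h] by simp
  qed
  then obtain j where j: "t < j" "0 < h j" "h(t := Suc (h t), j := h j - 1) \<in> U"
    using assms(2) g h lt unfolding wpoly_def by blast
  have "j \<in> W" using j mingen_outside[OF assms(1) h, of j] by fastforce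
  then show thesis using j that by blast
qed

lemma slice_mingen_lift:
  fixes t :: "'v::{finite,linorder}"
  assumes up: "upset_on (insert t W) U" and "t \<notin> W" and a: "a \<in> mingen (slice t k U)"
  obtains g where "g \<in> mingen U" "g t \<le> k" "g(t := 0) = a"
proof -
  have "a(t := k) \<in> U" using a by (simp add: mingen_def)
  then obtain g where g: "g \<in> mingen U" "g \<le> a(t := k)" by (rule mingen_below)
  have at: "a t = 0" using mingen_outside[OF upset_on_slice[OF up] a] assms(2) by simp
  have gk: "g t \<le> k" using le_funD[OF g(2), of t] by simp
  have "g(t := 0) \<in> slice t k U"
    using g(1) gk by (auto simp: mingen_def intro: upset_onD[OF up, of g])
  moreover have "g(t := 0) \<le> a" using g(2) at by (auto simp: le_fun_def split: if_splits)
  ultimately have "g(t := 0) = a" using a by (auto simp: mingen_def)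
  with g gk that show thesis by blast
qed

text \<open>Two minimal generators of the slice lift to minimal generators g and h of U, and the
  exchange property of U carries over once g t = h t. If h t < g t \<le> k, exchanging a variable j
  of h for t would keep the exponent of t at most k and give an element of the slice strictly below
  h with t erased.\<close>

lemma wpoly_slice:
  fixes t :: "'v::{finite,linorder}"
  assumes up: "upset_on (insert t W) U" and wp: "wpoly U" and W: "\<forall>w\<in>W. t < w"
  shows "wpoly (slice t k U)"
proof -
  have tW: "t \<notin> W" using W by auto
  have same: "h t \<ge> g t"
    if g: "g \<in> mingen U" "g t \<le> k" and h: "h \<in> mingen U" and hk: "h(t := 0) \<in> mingen (slice t k U)" for g h
  proof (rule ccontr)
    assume "\<not> h t \<ge> g t"
    then have lt: "h t < g t" by simp
    obtain j where j: "j \<in> W" "0 < h j" "h(t := Suc (h t), j := h j - 1) \<in> U"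
      by (rule wpoly_first[OF up wp W g(1) h lt])
    have "t \<noteq> j" using j tW by auto
    have "(h(t := 0))(j := (h(t := 0)) j - 1) \<in> slice t k U"
      using lt g(2) \<open>t \<noteq> j\<close> by (auto simp: slice_def intro: upset_onD[OF up j(3)])
    moreover have "0 < (h(t := 0)) j" using j \<open>t \<noteq> j\<close> by auto
    ultimately show False using mingen_not_lower[OF hk] by blast
  qed
  show ?thesis unfolding wpoly_def
  proof (intro ballI allI impI)
    fix a b s
    assume a: "a \<in> mingen (slice t k U)" and b: "b \<in> mingen (slice t k U)"
      and s: "(\<forall>i<s. a i = b i) \<and> b s < a s"
    have upk: "upset_on W (slice t k U)" by (rule upset_on_slice[OF up])
    have "s \<in> W" using s mingen_outside[OF upk a, of s] by fastforce
    then have ts: "t < s" using W by auto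
    obtain g where g: "g \<in> mingen U" "g t \<le> k" "g(t := 0) = a"
      by (rule slice_mingen_lift[OF up tW a])
    obtain h where h: "h \<in> mingen U" "h t \<le> k" "h(t := 0) = b"
      by (rule slice_mingen_lift[OF up tW b])
    have "g t = h t" using same[of g h] same[of h g] g h a b by auto
    then have "\<forall>i<s. g i = h i" using s g(3) h(3) by (metis fun_upd_other)
    moreover have "h s < g s" using s ts g(3) h(3) by (metis fun_upd_other less_irrefl)
    ultimately obtain j where j: "j > s" "0 < h j" "h(s := Suc (h s), j := h j - 1) \<in> U"
      using wp g(1) h(1) unfolding wpoly_def by blast
    have "(h(s := Suc (h s), j := h j - 1))(t := k) \<in> U"
      using h(2) ts j(1) by (intro upset_onD[OF up j(3)]) auto
    moreover have "b(s := Suc (b s), j := b j - 1, t := k) = (h(s := Suc (h s), j := h j - 1))(t := k)"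
      unfolding h(3)[symmetric] using ts j(1) by (auto simp: fun_eq_iff)
    ultimately show "\<exists>j>s. 0 < b j \<and> b(s := Suc (b s), j := b j - 1) \<in> slice t k U"
      using j ts h(3) by (intro exI[of _ j]) auto
  qed
qed

text \<open>As the slices still grow after k, some minimal generator g has g t > k, while x lies
  above a generator h with h t \<le> k. Exchanging a variable j of h for t pays for the step to k +
  1 with one unit of x j.\<close>

lemma wpoly_slice_step:
  fixes t :: "'v::{finite,linorder}"
  assumes up: "upset_on (insert t W) U" and wp: "wpoly U" and W: "\<forall>w\<in>W. t < w"
    and l: "k \<le> l" "slice t l U \<noteq> slice t k U"
  shows "slice t k U \<subseteq> mmul W (slice t (Suc k) U)"
proof
  fix x assume x: "x \<in> slice t k U"
  have "\<exists>y\<in>slice t l U. y \<notin> slice t k U" using l(2) slice_mono[OF up l(1), of t] by blast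
  then obtain y where y: "y(t := l) \<in> U" "y(t := k) \<notin> U" by auto
  obtain g where g: "g \<in> mingen U" "g \<le> y(t := l)" using mingen_below y(1) by blast
  have "k < g t"
  proof (rule ccontr)
    assume "\<not> k < g t"
    then have "g i \<le> (y(t := k)) i" for i using le_funD[OF g(2), of i] by auto
    then have "y(t := k) \<in> U" using g(1) upset_onD[OF up, of g] by (simp add: mingen_def)
    with y(2) show False ..
  qed
  obtain h where h: "h \<in> mingen U" "h \<le> x(t := k)" using mingen_below x by auto
  have "h t \<le> k" using le_funD[OF h(2), of t] by simp
  with \<open>k < g t\<close> have "h t < g t" by simp
  then obtain j where j: "j \<in> W" "0 < h j" "h(t := Suc (h t), j := h j - 1) \<in> U"
    by (rule wpoly_first[OF up wp W g(1) h(1)])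
  have "t \<noteq> j" using j W by auto
  have hx: "i \<noteq> t \<Longrightarrow> h i \<le> x i" for i using le_funD[OF h(2), of i] by simp
  have "x(j := x j - 1, t := Suc k) \<in> U"
    using \<open>h t \<le> k\<close> \<open>t \<noteq> j\<close> hx by (intro upset_onD[OF up j(3)]) (auto intro: diff_le_mono)
  moreover have "0 < x j" using j(2) hx[of j] \<open>t \<noteq> j\<close> by auto
  ultimately show "x \<in> mmul W (slice t (Suc k) U)" using j(1) by (auto simp: mmul_def)
qed

text \<open>If no slice were final, every member of a slice could be lowered by a variable of W to a
  member of the next slice, again and again; so all slices would be empty and hence equal. The least
  final index serves as d, which gives the second property.\<close>

lemma slices_stabilize:
  fixes t :: "'v::{finite,linorder}"
  assumes up: "upset_on (insert t W) U" and wp: "wpoly U" and W: "\<forall>w\<in>W. t < w"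
  obtains d where "\<And>k. d \<le> k \<Longrightarrow> slice t k U = slice t d U"
    and "\<And>k. k < d \<Longrightarrow> slice t k U \<subseteq> mmul W (slice t (Suc k) U)"
proof -
  define P where "P k \<longleftrightarrow> (\<forall>l\<ge>k. slice t l U = slice t k U)" for k
  have "\<exists>k. P k"
  proof (rule ccontr)
    assume "\<nexists>k. P k"
    then have step: "slice t k U \<subseteq> mmul W (slice t (Suc k) U)" for k
      using wpoly_slice_step[OF up wp W] unfolding P_def by metis
    have "x \<notin> slice t k U" for x k
    proof (induction "\<Sum>i\<in>UNIV. x i" arbitrary: x k rule: less_induct)
      case less
      show ?case
      proof
        assume "x \<in> slice t k U"
        then obtain j where j: "0 < x j" "x(j := x j - 1) \<in> slice t (Suc k) U"
          using step[of k] by (auto simp: mmul_def)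
        have "(\<Sum>i\<in>UNIV. (x(j := x j - 1)) i) < (\<Sum>i\<in>UNIV. x i)"
          using j(1) by (intro sum_strict_mono_ex1) auto
        from less[OF this] j(2) show False by blast
      qed
    qed
    then have "P 0" by (auto simp: P_def)
    with \<open>\<nexists>k. P k\<close> show False by blast
  qed
  then have "P (LEAST k. P k)" by (rule LeastI_ex)
  moreover have "slice t k U \<subseteq> mmul W (slice t (Suc k) U)" if "k < (LEAST k. P k)" for k
    using not_less_Least[OF that] wpoly_slice_step[OF up wp W] unfolding P_def by metis
  ultimately show thesis using that[of "LEAST k. P k"] unfolding P_def by blast
qed

section \<open>Koszul chains in a fixed multidegree\<close>

text \<open>For the ideal with exponent set U, the degree b part of the Koszul complex is a complex of
  scalars: c A is the coefficient of x^(b - A) e_A, where b - A is lower b A, and the Koszul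
  differential becomes kd with all coefficients 1.\<close>

definition lower :: "('v \<Rightarrow> nat) \<Rightarrow> 'v set \<Rightarrow> 'v \<Rightarrow> nat" where
  "lower b A i = (if i \<in> A then b i - 1 else b i)"

definition chains :: "('v \<Rightarrow> nat) set \<Rightarrow> 'v set \<Rightarrow> ('v \<Rightarrow> nat) \<Rightarrow> nat \<Rightarrow> ('v set \<Rightarrow> 'r::comm_ring_1) set" where
  "chains U W b i = {c. \<forall>A. c A \<noteq> 0 \<longrightarrow> A \<subseteq> W \<and> i \<le> card A \<and> (\<forall>j\<in>A. 0 < b j) \<and> lower b A \<in> U}"

abbreviation bd :: "('v::{finite,linorder} set \<Rightarrow> 'r::comm_ring_1) \<Rightarrow> 'v set \<Rightarrow> 'r" where
  "bd \<equiv> kd (\<lambda>_. 1)"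

text \<open>Chains may mix degrees: \<open>chains U W b s\<close> admits all sizes from s on, so one
  clause expresses vanishing in every degree at least s. The type argument fixes the
  coefficients.\<close>

definition acyclic_from :: "'r::comm_ring_1 itself \<Rightarrow> ('v::{finite,linorder} \<Rightarrow> nat) set \<Rightarrow> 'v set \<Rightarrow> nat \<Rightarrow> bool" where
  "acyclic_from R U W s \<longleftrightarrow> (\<forall>b. \<forall>c \<in> chains U W b s. (\<forall>A. bd c A = (0 :: 'r)) \<longrightarrow>
     (\<exists>w\<in>chains U W b 0. \<forall>A. bd w A = c A))"

text \<open>jn t p q stands for p + e_t q.\<close>

definition jn :: "'v \<Rightarrow> ('v set \<Rightarrow> 'r) \<Rightarrow> ('v set \<Rightarrow> 'r) \<Rightarrow> 'v set \<Rightarrow> 'r" where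
  "jn t p q A = (if t \<in> A then q (A - {t}) else p A)"

definition supp_on :: "'v set \<Rightarrow> ('v set \<Rightarrow> 'r::zero) \<Rightarrow> bool" where
  "supp_on W c \<longleftrightarrow> (\<forall>A. c A \<noteq> 0 \<longrightarrow> A \<subseteq> W)"

lemma chains_supp_on: "c \<in> chains U W b i \<Longrightarrow> supp_on W c"
  by (auto simp: chains_def supp_on_def)

lemma chains_zero [simp]: "(\<lambda>A. 0) \<in> chains U W b i"
  by (simp add: chains_def)

lemma chains_minus: "c \<in> chains U W b i \<Longrightarrow> (\<lambda>A. - c A) \<in> chains U W b i"
  by (simp add: chains_def)

lemma chains_add: "c \<in> chains U W b i \<Longrightarrow> d \<in> chains U W b i \<Longrightarrow> (\<lambda>A. c A + d A) \<in> chains U W b i"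
  unfolding chains_def mem_Collect_eq by (metis add_0)

lemma chains_mono: "c \<in> chains U W b i \<Longrightarrow> U \<subseteq> V \<Longrightarrow> j \<le> i \<Longrightarrow> c \<in> chains V W b j"
  unfolding chains_def by fastforce

text \<open>Chains over W do not see the degree at t, so it can be set to the number of a slice and
  restored afterwards.\<close>

lemma chains_upd:
  assumes "c \<in> chains U W b i" "t \<notin> W" "upset_on W U"
  shows "c \<in> chains U W (b(t := m)) i"
  unfolding chains_def
proof (intro CollectI allI impI)
  fix A assume "c A \<noteq> 0"
  then have A: "A \<subseteq> W" "i \<le> card A" "\<forall>j\<in>A. 0 < b j" "lower b A \<in> U"
    using assms(1) by (auto simp: chains_def)
  have "lower (b(t := m)) A \<in> U"
    by (rule upset_onD[OF assms(3) A(4)]) (use A(1) assms(2) in \<open>auto simp: lower_def\<close>)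
  then show "A \<subseteq> W \<and> i \<le> card A \<and> (\<forall>j\<in>A. 0 < (b(t := m)) j) \<and> lower (b(t := m)) A \<in> U"
    using A assms(2) by auto
qed

section \<open>The Koszul complex as a mapping cone over the first variable\<close>

lemma jn_split:
  assumes "supp_on (insert t W) c"
  obtains p q where "c = jn t p q" "supp_on W p" "supp_on W q"
proof
  let ?p = "\<lambda>A. if t \<in> A then 0 else c A" and ?q = "\<lambda>A. if t \<in> A then 0 else c (insert t A)"
  show "c = jn t ?p ?q" by (auto simp: jn_def fun_eq_iff insert_absorb)
  show "supp_on W ?p" "supp_on W ?q" using assms by (auto simp: supp_on_def)
qed

lemma jn_eqD:
  assumes "\<And>A. jn t p q A = jn t p' q' A" "t \<notin> W" "supp_on W p" "supp_on W q" "supp_on W p'" "supp_on W q'"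
  shows "p A = p' A" "q A = q' A"
proof -
  have "p A = p' A \<and> q A = q' A"
  proof (cases "t \<in> A")
    case True
    then have "\<not> A \<subseteq> W" using assms(2) by auto
    then show ?thesis using assms(3-) unfolding supp_on_def by metis
  next
    case False
    then show ?thesis using assms(1)[of A] assms(1)[of "insert t A"] by (simp add: jn_def)
  qed
  then show "p A = p' A" "q A = q' A" by auto
qed

lemma supp_on_kd: "supp_on W c \<Longrightarrow> supp_on W (kd x c)"
  unfolding supp_on_def kd_def
proof (intro allI impI)
  fix A assume c: "\<forall>A. c A \<noteq> 0 \<longrightarrow> A \<subseteq> W" and "(\<Sum>j\<in>-A. sgn_ins j A * x j * c (insert j A)) \<noteq> 0"
  then obtain j where "sgn_ins j A * x j * c (insert j A) \<noteq> 0" by (meson sum.not_neutral_contains_not_neutral)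
  then have "c (insert j A) \<noteq> 0" by auto
  with c show "A \<subseteq> W" by blast
qed

lemma supp_on_add: "supp_on W c \<Longrightarrow> supp_on W d \<Longrightarrow> supp_on W (\<lambda>A. c A + d A :: 'r::comm_ring_1)"
  unfolding supp_on_def by (metis add_0)

lemma supp_on_minus: "supp_on W c \<Longrightarrow> supp_on W (\<lambda>A. - c A :: 'r::comm_ring_1)"
  unfolding supp_on_def by simp

text \<open>As t precedes W, e_t stands first: removing it costs no sign, moving another index past
  it costs one. This is the differential of a mapping cone.\<close>

lemma bd_jn:
  fixes p q :: "'v::{finite,linorder} set \<Rightarrow> 'r::comm_ring_1"
  assumes W: "\<forall>w\<in>W. t < w" and p: "supp_on W p" and q: "supp_on W q"
  shows "bd (jn t p q) A = jn t (\<lambda>A. bd p A + q A) (\<lambda>A. - bd q A) A"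
proof (cases "t \<in> A")
  case True
  define B where "B = A - {t}"
  have A: "A = insert t B" "t \<notin> B" using True by (auto simp: B_def)
  have "bd q B = (\<Sum>j\<in>insert t (-A). sgn_ins j B * q (insert j B))"
    unfolding kd_def by (rule sum.cong) (use A in auto)
  also have "\<dots> = sgn_ins t B * q (insert t B) + (\<Sum>j\<in>-A. sgn_ins j B * q (insert j B))"
    using True by (subst sum.insert) auto
  also have "q (insert t B) = 0" using q W unfolding supp_on_def by blast
  finally have "- bd q B = (\<Sum>j\<in>-A. - (sgn_ins j B * q (insert j B)))" by (simp add: sum_negf)
  also have "\<dots> = bd (jn t p q) A"
    unfolding kd_def
  proof (rule sum.cong[OF refl])
    fix j assume j: "j \<in> - A"
    have "insert j A - {t} = insert j B" using A j by auto
    then have jq: "jn t p q (insert j A) = q (insert j B)" using True by (simp add: jn_def)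
    have "q (insert j B) = 0 \<or> t < j" using q W unfolding supp_on_def by blast
    moreover have "t < j \<Longrightarrow> sgn_ins j A = (- sgn_ins j B :: 'r)"
      using sgn_ins_insert[OF A(2), of j] A(1) by simp
    ultimately show "- (sgn_ins j B * q (insert j B)) = sgn_ins j A * 1 * jn t p q (insert j A)"
      unfolding jq by auto
  qed
  finally show ?thesis using True by (simp add: jn_def B_def)
next
  case False
  have "bd (jn t p q) A = (\<Sum>j\<in>insert t (-A-{t}). sgn_ins j A * jn t p q (insert j A))"
    unfolding kd_def by (rule sum.cong) (use False in auto)
  also have "\<dots> = sgn_ins t A * q A + (\<Sum>j\<in>-A-{t}. sgn_ins j A * p (insert j A))"
  proof -
    have "(\<Sum>j\<in>-A-{t}. sgn_ins j A * jn t p q (insert j A)) = (\<Sum>j\<in>-A-{t}. sgn_ins j A * p (insert j A))"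
      using False by (intro sum.cong) (auto simp: jn_def)
    then show ?thesis using False by (subst sum.insert) (auto simp: jn_def)
  qed
  also have "(\<Sum>j\<in>-A-{t}. sgn_ins j A * p (insert j A)) = bd p A"
  proof -
    have "p (insert t A) = 0" using p W unfolding supp_on_def by blast
    moreover have "bd p A = (\<Sum>j\<in>insert t (-A-{t}). sgn_ins j A * p (insert j A))"
      unfolding kd_def by (rule sum.cong) (use False in auto)
    ultimately show ?thesis by (subst (asm) sum.insert) auto
  qed
  also have "sgn_ins t A * q A = q A"
  proof (cases "q A = 0")
    case False
    then have "A \<subseteq> W" using q by (auto simp: supp_on_def)
    then have "{k \<in> A. k < t} = {}" using W by force
    then show ?thesis by (simp only: sgn_ins_def) simp
  qed simp
  finally show ?thesis using False by (simp add: jn_def[of _ _ _ A] add.commute)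
qed

text \<open>Using e_t lowers the exponent of t by one, so p lives over slice b t and q over slice b
  t - 1, one homological degree lower. For b t = 0 no e_t is available, and truncated subtraction
  would wrongly admit slice 0.\<close>

lemma jn_chains_iff:
  fixes t :: "'v::finite"
  assumes tW: "t \<notin> W" and p: "supp_on W p" and q: "supp_on W q"
  shows "jn t p q \<in> chains U (insert t W) b i \<longleftrightarrow> p \<in> chains (slice t (b t) U) W b i \<and>
    (if b t = 0 then (\<forall>A. q A = 0) else q \<in> chains (slice t (b t - 1) U) W b (i - 1))"
    (is "?L \<longleftrightarrow> ?R")
proof -
  have lp: "(lower b A)(t := b t) = lower b A" if "A \<subseteq> W" for A
    using that tW by (auto simp: lower_def fun_eq_iff)
  have lq: "lower b (insert t A) = (lower b A)(t := b t - 1)" if "A \<subseteq> W" for A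
    using that tW by (auto simp: lower_def fun_eq_iff)
  have cd: "i \<le> card (insert t A) \<longleftrightarrow> i - 1 \<le> card A" if "A \<subseteq> W" for A
    using that tW by (subst card_insert_disjoint) auto
  show ?thesis
  proof
    assume L: ?L
    have pc: "p A \<noteq> 0 \<Longrightarrow> A \<subseteq> W \<and> i \<le> card A \<and> (\<forall>j\<in>A. 0 < b j) \<and> lower b A \<in> slice t (b t) U" for A
    proof -
      assume pA: "p A \<noteq> 0"
      then have AW: "A \<subseteq> W" using p by (auto simp: supp_on_def)
      then have "jn t p q A \<noteq> 0" using tW pA by (auto simp: jn_def)
      with L AW show ?thesis by (auto simp: chains_def lp)
    qed
    have qc: "A \<subseteq> W \<and> 0 < b t \<and> i - 1 \<le> card A \<and> (\<forall>j\<in>A. 0 < b j) \<and> lower b A \<in> slice t (b t - 1) U"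
      if qA: "q A \<noteq> 0" for A
    proof -
      have AW: "A \<subseteq> W" using q qA by (auto simp: supp_on_def)
      then have "t \<notin> A" using tW by auto
      then have "jn t p q (insert t A) \<noteq> 0" using qA by (simp add: jn_def)
      then have "i \<le> card (insert t A) \<and> (\<forall>j\<in>insert t A. 0 < b j) \<and> lower b (insert t A) \<in> U"
        using L unfolding chains_def by blast
      then show ?thesis unfolding lq[OF AW] cd[OF AW] using AW by simp
    qed
    show ?R using pc qc unfolding chains_def by fastforce
  next
    assume R: ?R
    show ?L unfolding chains_def
    proof (intro CollectI allI impI)
      fix A assume nz: "jn t p q A \<noteq> 0"
      show "A \<subseteq> insert t W \<and> i \<le> card A \<and> (\<forall>j\<in>A. 0 < b j) \<and> lower b A \<in> U"
      proof (cases "t \<in> A")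
        case True
        then have qn: "q (A - {t}) \<noteq> 0" using nz by (simp add: jn_def)
        then have b: "b t \<noteq> 0" using R by (cases "b t = 0") auto
        then have *: "A - {t} \<subseteq> W \<and> i - 1 \<le> card (A - {t}) \<and> (\<forall>j\<in>A-{t}. 0 < b j) \<and>
            lower b (A - {t}) \<in> slice t (b t - 1) U"
          using R qn by (auto simp: chains_def)
        have "insert t (A - {t}) = A" using True by auto
        with * lq[of "A - {t}"] cd[of "A - {t}"] b show ?thesis by auto
      next
        case False
        then have "p A \<noteq> 0" using nz by (simp add: jn_def)
        then show ?thesis using R lp[of A] by (auto simp: chains_def)
      qed
    qed
  qed
qed

text \<open>Dividing by a variable of W stays in slice k; dividing by t lands in slice k - 1, which
  \<open>step\<close> puts into \<open>mmul W\<close> of slice k.\<close>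

lemma mmul_slice:
  assumes x: "x(t := k) \<in> mmul (insert t W) U" and tW: "t \<notin> W"
    and step: "\<And>k. k < d \<Longrightarrow> slice t k U \<subseteq> mmul W (slice t (Suc k) U)" and "k \<le> d"
  shows "x \<in> mmul W (slice t k U)"
proof -
  obtain j where j: "j \<in> insert t W" "0 < (x(t := k)) j" "(x(t := k))(j := (x(t := k)) j - 1) \<in> U"
    using x unfolding mmul_def by blast
  show ?thesis
  proof (cases "j = t")
    case True
    then have "x(t := k - 1) \<in> U" "0 < k" using j by auto
    then have "x \<in> slice t (k - 1) U" "slice t (k - 1) U \<subseteq> mmul W (slice t k U)"
      using step[of "k - 1"] \<open>k \<le> d\<close> by auto
    then show ?thesis by blast
  next
    case False
    then have "j \<in> W" "0 < x j" "(x(j := x j - 1))(t := k) \<in> U" using j by (auto simp: fun_upd_twist)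
    then show ?thesis by (auto simp: mmul_def)
  qed
qed

text \<open>The inclusion of the maximal ideal times I into I is zero on Koszul homology.\<close>

lemma mmul_cycle_bounds:
  fixes W :: "'v::{finite,linorder} set" and c :: "'v set \<Rightarrow> 'r::comm_ring_1"
  assumes "upset_on W U" "wpoly U" "c \<in> chains (mmul W U) W b i" "\<And>A. bd c A = 0"
  shows "\<exists>w\<in>chains U W b (Suc i). \<forall>A. bd w A = c A"
  using finite[of W] assms
proof (induction W arbitrary: U c b i rule: finite_linorder_min_induct)
  case empty
  then have "c A = 0" for A by (auto simp: chains_def mmul_def)
  then show ?case by (intro bexI[of _ "\<lambda>A. 0"]) auto
next
  case (insert t W)
  note up = insert.prems(1) and wp = insert.prems(2) and c = insert.prems(3) and cyc = insert.prems(4)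
  have W: "\<forall>w\<in>W. t < w" and tW: "t \<notin> W" using insert.hyps by auto
  obtain d where stable: "\<And>k. d \<le> k \<Longrightarrow> slice t k U = slice t d U"
    and step: "\<And>k. k < d \<Longrightarrow> slice t k U \<subseteq> mmul W (slice t (Suc k) U)"
    using slices_stabilize[OF up wp W] by blast
  note IH = insert.IH[OF upset_on_slice[OF up] wpoly_slice[OF up wp W]]
  obtain p q where pq: "c = jn t p q" and p: "supp_on W p" and q: "supp_on W q"
    by (rule jn_split[OF chains_supp_on[OF c]])
  have cc: "p \<in> chains (slice t (b t) (mmul (insert t W) U)) W b i"
    "if b t = 0 then (\<forall>A. q A = 0) else q \<in> chains (slice t (b t - 1) (mmul (insert t W) U)) W b (i - 1)"
    using c unfolding pq jn_chains_iff[OF tW p q] by auto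
  have eq0: "jn t (\<lambda>A. bd p A + q A) (\<lambda>A. - bd q A) A = jn t (\<lambda>A. 0) (\<lambda>A. 0) A" for A
    using cyc[of A] unfolding pq bd_jn[OF W p q] by (simp add: jn_def)
  have s: "supp_on W (\<lambda>A. bd p A + q A)" "supp_on W (\<lambda>A. - bd q A)" "supp_on W (\<lambda>A. 0 :: 'r)"
    using p q by (auto intro: supp_on_add supp_on_minus supp_on_kd simp: supp_on_def[of W "\<lambda>A. 0"])
  have pq0: "bd p A + q A = 0" for A using jn_eqD(1)[OF eq0 tW s(1,2) s(3,3)] .
  have q0: "bd q A = 0" for A using jn_eqD(2)[OF eq0 tW s(1,2) s(3,3)] by simp
  show ?case
  proof (cases "b t \<le> d")
    case True
    \<comment> \<open>As q is a cycle over \<open>mmul W\<close> of slice b t - 1, it bounds some v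
      over that slice, which lies in \<open>mmul W\<close> of slice b t. So p + v is a cycle over
      the latter and bounds some w; then c is the boundary of w - e_t v.\<close>
    obtain v where v: "v \<in> chains (mmul W (slice t (b t) U)) W b i" "\<And>A. bd v A = q A"
      and v': "if b t = 0 then (\<forall>A. v A = 0) else v \<in> chains (slice t (b t - 1) U) W b (Suc i - 1)"
    proof (cases "b t = 0")
      case True
      then show thesis using that[of "\<lambda>A. 0"] cc(2) by auto
    next
      case False
      have "slice t (b t - 1) (mmul (insert t W) U) \<subseteq> mmul W (slice t (b t - 1) U)"
        using mmul_slice[OF _ tW step] True by auto
      then have "q \<in> chains (mmul W (slice t (b t - 1) U)) W b (i - 1)"
        using chains_mono cc(2) False by fastforce
      from IH[OF this q0] obtain v where v: "v \<in> chains (slice t (b t - 1) U) W b (Suc (i - 1))" "\<forall>A. bd v A = q A"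
        by blast
      then have v2: "v \<in> chains (slice t (b t - 1) U) W b i" by (auto intro: chains_mono)
      then have "v \<in> chains (mmul W (slice t (b t) U)) W b i"
        by (rule chains_mono) (use step[of "b t - 1"] True False in auto)
      then show thesis using that[of v] v v2 False by auto
    qed
    have "slice t (b t) (mmul (insert t W) U) \<subseteq> mmul W (slice t (b t) U)"
      using mmul_slice[OF _ tW step] True by auto
    then have "(\<lambda>A. p A + v A) \<in> chains (mmul W (slice t (b t) U)) W b i"
      using cc(1) v(1) by (intro chains_add) (auto intro: chains_mono)
    moreover have "bd (\<lambda>A. p A + v A) A = 0" for A
      using pq0[of A] by (simp add: kd_add v)
    ultimately obtain w where w: "w \<in> chains (slice t (b t) U) W b (Suc i)" "\<And>A. bd w A = p A + v A"
      using IH by blast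
    have sv: "supp_on W (\<lambda>A. - v A)" and sw: "supp_on W w"
      using v(1) w(1) by (auto intro: chains_supp_on supp_on_minus)
    show ?thesis
    proof (intro bexI[of _ "jn t w (\<lambda>A. - v A)"] allI)
      show "bd (jn t w (\<lambda>A. - v A)) A = c A" for A
        unfolding bd_jn[OF W sw sv] pq by (simp add: jn_def w v kd_minus)
      show "jn t w (\<lambda>A. - v A) \<in> chains U (insert t W) b (Suc i)"
        unfolding jn_chains_iff[OF tW sw sv] using w v' by (auto intro: chains_minus)
    qed
  next
    case False
    \<comment> \<open>Beyond d the slices b t - 1 and b t coincide, so e_t p is a chain for U, with
      boundary p - e_t bd p = c.\<close>
    have "slice t (b t) (mmul (insert t W) U) \<subseteq> slice t (b t - 1) U"
    proof -
      have "slice t (b t) (mmul (insert t W) U) \<subseteq> slice t (b t) U"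
        using mmul_subset[OF up, of "insert t W"] by auto
      also have "slice t (b t) U = slice t (b t - 1) U"
        using stable[of "b t"] stable[of "b t - 1"] False by simp
      finally show ?thesis .
    qed
    then have p': "p \<in> chains (slice t (b t - 1) U) W b (Suc i - 1)"
      using cc(1) by (auto intro: chains_mono)
    have s0: "supp_on W (\<lambda>A. 0 :: 'r)" by (rule s(3))
    show ?thesis
    proof (intro bexI[of _ "jn t (\<lambda>A. 0) p"] allI)
      show "bd (jn t (\<lambda>A. 0) p) A = c A" for A
        unfolding bd_jn[OF W s0 p] pq using pq0 by (simp add: jn_def add_eq_0_iff)
      show "jn t (\<lambda>A. 0) p \<in> chains U (insert t W) b (Suc i)"
        unfolding jn_chains_iff[OF tW s0 p] using p' False by auto
    qed
  qed
qed

text \<open>Place a cycle c of slice d in degree d of t and bound it over U by p + e_t q. Then c =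
  bd p + q with q a cycle over slice d - 1. That slice lies in \<open>mmul W\<close> of slice d, so
  q bounds over slice d, and c with it.\<close>

lemma acyclic_slice_stable:
  fixes U :: "('v::{finite,linorder} \<Rightarrow> nat) set"
  assumes up: "upset_on (insert t W) U" and wp: "wpoly U" and W: "\<forall>w\<in>W. t < w"
    and step: "\<And>k. k < d \<Longrightarrow> slice t k U \<subseteq> mmul W (slice t (Suc k) U)"
    and ac: "acyclic_from TYPE('r::comm_ring_1) U (insert t W) s"
  shows "acyclic_from TYPE('r) (slice t d U) W s"
  unfolding acyclic_from_def
proof (intro allI ballI impI)
  fix b0 and c :: "'v set \<Rightarrow> 'r"
  assume c0: "c \<in> chains (slice t d U) W b0 s" and cyc: "\<forall>A. bd c A = 0"
  have tW: "t \<notin> W" using W by auto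
  note upd = upset_on_slice[OF up]
  define b where "b = b0(t := d)"
  have c: "c \<in> chains (slice t d U) W b s" unfolding b_def by (rule chains_upd[OF c0 tW upd])
  have sc: "supp_on W c" and s0: "supp_on W (\<lambda>A. 0 :: 'r)"
    using chains_supp_on[OF c] by (auto simp: supp_on_def)
  have "jn t c (\<lambda>A. 0) \<in> chains U (insert t W) b s"
    unfolding jn_chains_iff[OF tW sc s0] using c by (simp add: b_def)
  moreover have "bd (jn t c (\<lambda>A. 0)) A = 0" for A
    unfolding bd_jn[OF W sc s0] using cyc by (simp add: jn_def)
  ultimately obtain w where w: "w \<in> chains U (insert t W) b 0" "\<And>A. bd w A = jn t c (\<lambda>A. 0) A"
    using ac unfolding acyclic_from_def by blast
  obtain p q where pq: "w = jn t p q" and p: "supp_on W p" and q: "supp_on W q"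
    by (rule jn_split[OF chains_supp_on[OF w(1)]])
  have wc: "p \<in> chains (slice t d U) W b 0"
    "if d = 0 then (\<forall>A. q A = 0) else q \<in> chains (slice t (d - 1) U) W b 0"
    using w(1) unfolding pq jn_chains_iff[OF tW p q] by (auto simp: b_def)
  have eq: "jn t (\<lambda>A. bd p A + q A) (\<lambda>A. - bd q A) A = jn t c (\<lambda>A. 0) A" for A
    using w(2)[of A] unfolding pq bd_jn[OF W p q] .
  have s: "supp_on W (\<lambda>A. bd p A + q A)" "supp_on W (\<lambda>A. - bd q A)"
    using p q by (auto intro: supp_on_add supp_on_minus supp_on_kd)
  have pc: "bd p A + q A = c A" for A using jn_eqD(1)[OF eq tW s sc s0] .
  have q0: "bd q A = 0" for A using jn_eqD(2)[OF eq tW s sc s0] by simp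
  obtain v where v: "v \<in> chains (slice t d U) W b 0" "\<And>A. bd v A = q A"
  proof (cases "d = 0")
    case True
    then show thesis using that[of "\<lambda>A. 0"] wc(2) by auto
  next
    case False
    then have "q \<in> chains (mmul W (slice t d U)) W b 0"
      using wc(2) step[of "d - 1"] by (auto intro: chains_mono)
    from mmul_cycle_bounds[OF upd wpoly_slice[OF up wp W] this q0]
    show thesis using that by (meson chains_mono order_refl zero_le)
  qed
  have "(\<lambda>A. p A + v A) \<in> chains (slice t d U) W b 0"
    using wc(1) v(1) by (rule chains_add)
  then have "(\<lambda>A. p A + v A) \<in> chains (slice t d U) W (b(t := b0 t)) 0"
    by (rule chains_upd[OF _ tW upd])
  then show "\<exists>w\<in>chains (slice t d U) W b0 0. \<forall>A. bd w A = c A"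
    using pc v(2) by (intro bexI[of _ "\<lambda>A. p A + v A"]) (auto simp: kd_add b_def)
qed

text \<open>A cycle c of slice k bounds some z over slice k + 1, one homological degree higher. So
  e_t c - z is a cycle for U, and bounding it by p + e_t q leaves c = - bd q in the part with
  e_t.\<close>

lemma acyclic_slice_step:
  fixes U :: "('v::{finite,linorder} \<Rightarrow> nat) set"
  assumes up: "upset_on (insert t W) U" and wp: "wpoly U" and W: "\<forall>w\<in>W. t < w"
    and step: "slice t k U \<subseteq> mmul W (slice t (Suc k) U)"
    and ac: "acyclic_from TYPE('r::comm_ring_1) U (insert t W) (Suc s)"
  shows "acyclic_from TYPE('r) (slice t k U) W s"
  unfolding acyclic_from_def
proof (intro allI ballI impI)
  fix b0 and c :: "'v set \<Rightarrow> 'r"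
  assume c0: "c \<in> chains (slice t k U) W b0 s" and cyc: "\<forall>A. bd c A = 0"
  have tW: "t \<notin> W" using W by auto
  note upk = upset_on_slice[OF up]
  define b where "b = b0(t := Suc k)"
  have c: "c \<in> chains (slice t k U) W b s" unfolding b_def by (rule chains_upd[OF c0 tW upk])
  then have "c \<in> chains (mmul W (slice t (Suc k) U)) W b s" using step by (auto intro: chains_mono)
  from mmul_cycle_bounds[OF upk wpoly_slice[OF up wp W] this] cyc
  obtain z where z: "z \<in> chains (slice t (Suc k) U) W b (Suc s)" "\<And>A. bd z A = c A" by auto
  have sc: "supp_on W c" and sz: "supp_on W (\<lambda>A. - z A)"
    using c z(1) by (auto intro: chains_supp_on supp_on_minus)
  have "jn t (\<lambda>A. - z A) c \<in> chains U (insert t W) b (Suc s)"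
    unfolding jn_chains_iff[OF tW sz sc] using c chains_minus[OF z(1)] by (simp add: b_def)
  moreover have "bd (jn t (\<lambda>A. - z A) c) A = 0" for A
    unfolding bd_jn[OF W sz sc] using cyc by (simp add: jn_def kd_minus z(2))
  ultimately obtain w where w: "w \<in> chains U (insert t W) b 0" "\<And>A. bd w A = jn t (\<lambda>A. - z A) c A"
    using ac unfolding acyclic_from_def by blast
  obtain p q where pq: "w = jn t p q" and p: "supp_on W p" and q: "supp_on W q"
    by (rule jn_split[OF chains_supp_on[OF w(1)]])
  have wc: "q \<in> chains (slice t k U) W b 0"
    using w(1) unfolding pq jn_chains_iff[OF tW p q] by (simp add: b_def)
  have eq: "jn t (\<lambda>A. bd p A + q A) (\<lambda>A. - bd q A) A = jn t (\<lambda>A. - z A) c A" for A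
    using w(2)[of A] unfolding pq bd_jn[OF W p q] .
  have s: "supp_on W (\<lambda>A. bd p A + q A)" "supp_on W (\<lambda>A. - bd q A)"
    using p q by (auto intro: supp_on_add supp_on_minus supp_on_kd)
  have qc: "- bd q A = c A" for A using jn_eqD(2)[OF eq tW s sz sc] .
  have "(\<lambda>A. - q A) \<in> chains (slice t k U) W (b(t := b0 t)) 0"
    by (rule chains_upd[OF chains_minus[OF wc] tW upk])
  then show "\<exists>w\<in>chains (slice t k U) W b0 0. \<forall>A. bd w A = c A"
    using qc by (intro bexI[of _ "\<lambda>A. - q A"]) (auto simp: kd_minus b_def)
qed

section \<open>Partitions into cones\<close>

definition cone :: "('v \<Rightarrow> nat) \<Rightarrow> 'v set \<Rightarrow> ('v \<Rightarrow> nat) set" where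
  "cone a Z = {x. \<forall>i. a i \<le> x i \<and> (i \<notin> Z \<longrightarrow> x i = a i)}"

definition std :: "'v set \<Rightarrow> ('v \<Rightarrow> nat) set \<Rightarrow> ('v \<Rightarrow> nat) set" where
  "std W U = {x. (\<forall>i. i \<notin> W \<longrightarrow> x i = 0) \<and> x \<notin> U}"

definition cone_partition :: "(('v \<Rightarrow> nat) \<times> 'v set) set \<Rightarrow> ('v \<Rightarrow> nat) set \<Rightarrow> bool" where
  "cone_partition D S \<longleftrightarrow> finite D \<and> (\<forall>(a,Z)\<in>D. cone a Z \<subseteq> S) \<and>
     (\<forall>x\<in>S. \<exists>!p. p \<in> D \<and> x \<in> cone (fst p) (snd p))"

lemma cone_self: "a \<in> cone a Z"
  by (simp add: cone_def)

text \<open>In the degree of a minimal generator g only the empty set carries chains, since lowering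
  g leaves U. The coefficient 1 there is a cycle that nothing bounds.\<close>

lemma acyclic_zero_empty:
  fixes U :: "('v::{finite,linorder} \<Rightarrow> nat) set"
  assumes "acyclic_from TYPE('k::comm_ring_1) U W 0"
  shows "U = {}"
proof (rule ccontr)
  assume "U \<noteq> {}"
  then obtain g where g: "g \<in> mingen U" using mingen_below by blast
  define c :: "'v set \<Rightarrow> 'k" where "c A = (if A = {} then 1 else 0)" for A
  have "c \<in> chains U W g 0"
    using g by (auto simp: chains_def c_def lower_def[abs_def] mingen_def)
  moreover have "bd c A = 0" for A by (simp add: kd_def c_def)
  ultimately obtain w where w: "w \<in> chains U W g 0" "bd w {} = c {}"
    using assms unfolding acyclic_from_def by blast
  have "w A = 0" if ne: "A \<noteq> {}" for A
  proof (rule ccontr)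
    assume "w A \<noteq> 0"
    then have A: "\<forall>j\<in>A. 0 < g j" "lower g A \<in> U" using w(1) by (auto simp: chains_def)
    have "lower g A \<le> g" by (simp add: lower_def le_fun_def)
    then have eq: "lower g A = g" using A(2) g by (simp add: mingen_def)
    obtain j where "j \<in> A" using ne by blast
    with A(1) fun_cong[OF eq, of j] show False by (auto simp: lower_def)
  qed
  then have "bd w {} = 0" by (simp add: kd_def)
  with w(2) show False by (simp add: c_def)
qed

lemma cone_partition_empty_upset:
  "cone_partition {(\<lambda>_. 0, W)} (std W {})"
  by (auto simp: cone_partition_def cone_def std_def)

text \<open>Exponent k < d of t shows a copy of the standard monomials of slice k; all exponents
  from d on show slice d, whose cones are extended in direction t. The degree gained below d by
  \<open>acyclic_slice_step\<close> makes up for the missing direction.\<close>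

lemma cone_partition_exists:
  fixes W :: "'v::{finite,linorder} set"
  assumes "upset_on W U" "wpoly U" "acyclic_from TYPE('k::comm_ring_1) U W s"
  shows "\<exists>D. cone_partition D (std W U) \<and> (\<forall>(a,Z)\<in>D. card W \<le> card Z + s)"
  using finite[of W] assms
proof (induction W arbitrary: U s rule: finite_linorder_min_induct)
  case empty
  show ?case
  proof (cases "U = {}")
    case True
    then show ?thesis using cone_partition_empty_upset[of "{}"] by auto
  next
    case False
    then obtain u where u: "u \<in> U" by blast
    have "x \<in> U" for x by (rule upset_onD[OF empty.prems(1) u]) auto
    then have "U = UNIV" by auto
    then show ?thesis by (intro exI[of _ "{}"]) (auto simp: cone_partition_def std_def)
  qed
next
  case (insert t W)
  note up = insert.prems(1) and wp = insert.prems(2) and ac = insert.prems(3)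
  have W: "\<forall>w\<in>W. t < w" and tW: "t \<notin> W" using insert.hyps by auto
  show ?case
  proof (cases "U = {}")
    case True
    then show ?thesis using cone_partition_empty_upset[of "insert t W"] by auto
  next
    case False
    \<comment> \<open>Slices below d get the bound s - 1, so s has to be positive; s = 0 would force
      U to be empty.\<close>
    then obtain s' where s': "s = Suc s'" using ac acyclic_zero_empty by (cases s) auto
    obtain d where stable: "\<And>k. d \<le> k \<Longrightarrow> slice t k U = slice t d U"
      and step: "\<And>k. k < d \<Longrightarrow> slice t k U \<subseteq> mmul W (slice t (Suc k) U)"
      using slices_stabilize[OF up wp W] by blast
    have acd: "acyclic_from TYPE('k) (slice t d U) W s"
      by (rule acyclic_slice_stable[OF up wp W step ac])
    have ack: "acyclic_from TYPE('k) (slice t k U) W s'" if "k < d" for k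
      using acyclic_slice_step[OF up wp W step[OF that]] ac s' by simp
    have "\<exists>D. cone_partition D (std W (slice t k U)) \<and>
        (\<forall>(a,Z)\<in>D. card W \<le> card Z + (if k = d then s else s'))" if "k \<le> d" for k
      using insert.IH[OF upset_on_slice[OF up] wpoly_slice[OF up wp W]] acd ack[of k] that by auto
    then obtain D where D: "\<And>k. k \<le> d \<Longrightarrow> cone_partition (D k) (std W (slice t k U))"
      and cd: "\<And>k a Z. k \<le> d \<Longrightarrow> (a,Z) \<in> D k \<Longrightarrow> card W \<le> card Z + (if k = d then s else s')"
      by (metis (no_types, lifting) case_prodD)
    define G where "G k = (\<lambda>(a :: 'v \<Rightarrow> nat, Z). (a(t := k), if k = d then insert t Z else Z))" for k
    define E where "E = (\<Union>k\<le>d. G k ` D k)"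
    have tail: "a t = 0" "t \<notin> Z" if "k \<le> d" "(a,Z) \<in> D k" for k a Z
    proof -
      have sub: "cone a Z \<subseteq> std W (slice t k U)" using D[OF that(1)] that(2) by (auto simp: cone_partition_def)
      show "a t = 0" using subsetD[OF sub cone_self] tW by (simp add: std_def)
      show "t \<notin> Z"
      proof
        assume "t \<in> Z"
        then have "a(t := Suc (a t)) \<in> cone a Z" by (simp add: cone_def)
        then have "a(t := Suc (a t)) \<in> std W (slice t k U)" using sub by blast
        then have "Suc (a t) = 0" using tW unfolding std_def by (metis (mono_tags, lifting) fun_upd_same mem_Collect_eq)
        then show False by simp
      qed
    qed
    \<comment> \<open>The level of x is min (x t) d, all levels from d on being merged into
      d.\<close>
    have mem: "x \<in> cone (fst (G k p)) (snd (G k p)) \<longleftrightarrow> min (x t) d = k \<and> x(t := 0) \<in> cone (fst p) (snd p)"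
      if k: "k \<le> d" and p: "p \<in> D k" for x k p
    proof -
      obtain a Z where [simp]: "p = (a,Z)" by (cases p)
      have a: "a t = 0" "t \<notin> Z" using tail k p by auto
      show ?thesis
      proof (cases "k = d")
        case True
        then show ?thesis using a by (auto simp: G_def cone_def split: if_splits)
      next
        case False
        then show ?thesis using a k by (auto simp: G_def cone_def min_def split: if_splits)
      qed
    qed
    have std: "x \<in> std (insert t W) U \<longleftrightarrow> x(t := 0) \<in> std W (slice t (min (x t) d) U)" for x
    proof -
      have "x(t := min (x t) d) \<in> U \<longleftrightarrow> x \<in> U"
      proof (cases "x t \<le> d")
        case False
        then have "x \<in> slice t (x t) U \<longleftrightarrow> x \<in> slice t d U" using stable[of "x t"] by simp
        then show ?thesis using False by simp
      qed (simp add: min_def)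
      then show ?thesis using tW by (auto simp: std_def)
    qed
    have "finite E" unfolding E_def using D by (auto simp: cone_partition_def)
    moreover have "cone (fst q) (snd q) \<subseteq> std (insert t W) U" if "q \<in> E" for q
    proof
      fix x assume x: "x \<in> cone (fst q) (snd q)"
      obtain k p where k: "k \<le> d" "p \<in> D k" "q = G k p" using \<open>q \<in> E\<close> by (auto simp: E_def)
      have "cone (fst p) (snd p) \<subseteq> std W (slice t k U)"
        using D[OF k(1)] k(2) unfolding cone_partition_def case_prod_beta by blast
      then show "x \<in> std (insert t W) U" using x unfolding std k(3) mem[OF k(1,2)] by auto
    qed
    moreover have "\<exists>!q. q \<in> E \<and> x \<in> cone (fst q) (snd q)" if x: "x \<in> std (insert t W) U" for x
    proof -
      let ?k = "min (x t) d"
      obtain p where p: "p \<in> D ?k" "x(t := 0) \<in> cone (fst p) (snd p)"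
        and u: "\<And>p'. p' \<in> D ?k \<Longrightarrow> x(t := 0) \<in> cone (fst p') (snd p') \<Longrightarrow> p' = p"
      proof -
        have "x(t := 0) \<in> std W (slice t ?k U)" using x std by blast
        then have "\<exists>!p. p \<in> D ?k \<and> x(t := 0) \<in> cone (fst p) (snd p)"
          using D[OF min.cobounded2] unfolding cone_partition_def by blast
        then show thesis using that by blast
      qed
      show ?thesis
      proof (rule ex1I[of _ "G ?k p"])
        show "G ?k p \<in> E \<and> x \<in> cone (fst (G ?k p)) (snd (G ?k p))"
          using p mem[OF _ p(1)] by (auto simp: E_def)
      next
        fix q assume q: "q \<in> E \<and> x \<in> cone (fst q) (snd q)"
        then obtain k p' where k: "k \<le> d" "p' \<in> D k" "q = G k p'" by (auto simp: E_def)
        with q have "?k = k" "x(t := 0) \<in> cone (fst p') (snd p')" using mem[OF k(1,2)] by auto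
        with u k show "q = G ?k p" by auto
      qed
    qed
    ultimately have "cone_partition E (std (insert t W) U)"
      unfolding cone_partition_def case_prod_beta by blast
    moreover have "card (insert t W) \<le> card Z + s" if q: "(a,Z) \<in> E" for a Z
    proof -
      obtain k a' Z' where k: "k \<le> d" "(a',Z') \<in> D k" "(a,Z) = G k (a',Z')" using q by (auto simp: E_def)
      then have "Z = (if k = d then insert t Z' else Z')" by (simp add: G_def)
      then show ?thesis using cd[OF k(1,2)] tail(2)[OF k(1,2)] tW s' by auto
    qed
    ultimately show ?thesis by blast
  qed
qed

section \<open>Koszul homology and regular sequences\<close>

text \<open>Ideals are the submodules of the ring over itself: \<open>rmod.span\<close> generates
  ideals and \<open>rmod.subspace\<close> recognizes them.\<close>

interpretation rmod: module "(*) :: 'a::comm_ring_1 \<Rightarrow> 'a \<Rightarrow> 'a"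
  by standard (simp_all add: algebra_simps)

definition var :: "'v \<Rightarrow> ('v, 'k::comm_ring_1) mpoly" where
  "var j = mon (Poly_Mapping.single j 1)"

text \<open>Chains of S/J are represented by lifts to S, equality being membership of the difference
  in J. There is no splitting by multidegree, because J may contain non-homogeneous regular
  elements.\<close>

definition koszul_nz :: "('v::{finite,linorder}, 'k::comm_ring_1) mpoly set \<Rightarrow> nat \<Rightarrow> bool" where
  "koszul_nz J s \<longleftrightarrow> (\<exists>z. (\<forall>A. z A \<noteq> 0 \<longrightarrow> s \<le> card A) \<and> (\<forall>A. kd var z A \<in> J) \<and>
     \<not> (\<exists>y. \<forall>A. z A - kd var y A \<in> J))"

lemma ideal_gen_eq_span: "ideal_gen G = rmod.span G"
  by (auto simp: ideal_gen_def rmod.span_explicit)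

lemma poly_sum_monomials: "(\<Sum>a\<in>Poly_Mapping.keys f. Poly_Mapping.single a (Poly_Mapping.lookup f a)) = f"
  by (rule poly_mapping_eqI) (simp add: lookup_sum lookup_single when_def sum.delta in_keys_iff)

lemma lookup_mon_mult:
  fixes a x :: "'v \<Rightarrow>\<^sub>0 nat"
  shows "Poly_Mapping.lookup (mon a * f) x = (if mdvd a x then Poly_Mapping.lookup f (x - a) else 0)"
proof -
  have x: "a + y = x \<longleftrightarrow> mdvd a x \<and> y = x - a" for y
    by (auto simp: mdvd_def poly_mapping_eq_iff lookup_add lookup_minus fun_eq_iff)
       (metis le_add1, metis add_diff_cancel_left')
  have "mon a * f = (\<Sum>y\<in>Poly_Mapping.keys f. Poly_Mapping.single (a + y) (Poly_Mapping.lookup f y))"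
    by (subst (1) poly_sum_monomials[of f, symmetric]) (simp add: mon_def sum_distrib_left mult_single)
  then have "Poly_Mapping.lookup (mon a * f) x = (\<Sum>y\<in>Poly_Mapping.keys f. if a + y = x then Poly_Mapping.lookup f y else 0)"
    by (simp add: lookup_sum lookup_single when_def)
  also have "\<dots> = (if mdvd a x then Poly_Mapping.lookup f (x - a) else 0)"
    by (auto simp: x sum.delta in_keys_iff)
  finally show ?thesis .
qed

lemma max_ideal_expand:
  fixes f :: "('v::finite, 'k::comm_ring_1) mpoly"
  assumes "f \<in> max_ideal"
  obtains F where "f = (\<Sum>j\<in>UNIV. F j * var j)"
proof -
  have "Poly_Mapping.single y c \<in> rmod.span (range var)" if ne: "y \<noteq> 0" for y :: "'v \<Rightarrow>\<^sub>0 nat" and c :: 'k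
  proof -
    obtain j where j: "Poly_Mapping.lookup y j \<noteq> 0" using ne by (auto simp: poly_mapping_eq_iff fun_eq_iff)
    then have "(y - Poly_Mapping.single j 1) + Poly_Mapping.single j 1 = y"
      by (auto simp: poly_mapping_eq_iff fun_eq_iff lookup_add lookup_minus lookup_single when_def)
    then have "Poly_Mapping.single y c = Poly_Mapping.single (y - Poly_Mapping.single j 1) c * var j"
      by (simp add: var_def mon_def mult_single)
    then show ?thesis by (simp add: rmod.span_base rmod.span_scale)
  qed
  then have "(\<Sum>a\<in>Poly_Mapping.keys f. Poly_Mapping.single a (Poly_Mapping.lookup f a)) \<in> rmod.span (range var)"
    using assms by (intro rmod.span_sum) (metis (mono_tags, lifting) in_keys_iff max_ideal_def mem_Collect_eq)
  then have "f \<in> rmod.span (range var)" by (simp only: poly_sum_monomials)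
  then obtain u where u: "f = (\<Sum>v\<in>range var. u v * v)" by (auto simp: rmod.span_finite)
  have "inj (var :: 'v \<Rightarrow> ('v, 'k) mpoly)"
    by (rule injI) (metis var_def mon_def keys_single one_neq_zero singleton_inject)
  then have "f = (\<Sum>j\<in>UNIV. u (var j) * var j)" unfolding u by (simp add: sum.reindex)
  then show thesis by (rule that)
qed

lemma wedge_nonzeroE:
  assumes "wedge F c A \<noteq> 0"
  obtains j where "j \<in> A" "F j \<noteq> 0" "c (A - {j}) \<noteq> 0"
proof -
  obtain j where "j \<in> A" "sgn_ins j (A - {j}) * F j * c (A - {j}) \<noteq> 0"
    using sum.not_neutral_contains_not_neutral[OF assms[unfolded wedge_def]] .
  then show thesis using that[of j] by fastforce
qed

lemma wedge_in_ideal: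
  assumes "rmod.subspace J" "\<And>A. c A \<in> J"
  shows "wedge F c A \<in> J"
  unfolding wedge_def by (intro rmod.subspace_sum rmod.subspace_scale assms)

lemma kd_in_ideal:
  assumes "rmod.subspace J" "\<And>A. c A \<in> J"
  shows "kd x c A \<in> J"
  unfolding kd_def by (intro rmod.subspace_sum rmod.subspace_scale assms)

text \<open>If z is a cycle modulo J that does not bound and f = F.x, then dz being in J makes F \<and> z a
  cycle modulo (J, f); were it a boundary, cancelling the regular element f would make z one.\<close>

lemma koszul_nz_insert:
  fixes J :: "('v::{finite,linorder}, 'k::comm_ring_1) mpoly set"
  assumes J: "rmod.subspace J" and f: "f \<in> max_ideal"
    and reg: "\<And>g. f * g \<in> J \<Longrightarrow> g \<in> J" and nz: "koszul_nz J s"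
  shows "koszul_nz (rmod.span (insert f J)) (Suc s)"
proof -
  let ?K = "rmod.span (insert f J)"
  have JK: "J \<subseteq> ?K" using rmod.span_superset by blast
  have K: "g \<in> ?K \<longleftrightarrow> (\<exists>k. g - k * f \<in> J)" for g
    by (simp only: rmod.span_breakdown_eq rmod.span_eq_iff[THEN iffD2, OF J])
  obtain z where z: "\<And>A. z A \<noteq> 0 \<Longrightarrow> s \<le> card A" "\<And>A. kd var z A \<in> J"
    and nb: "\<not> (\<exists>y. \<forall>A. z A - kd var y A \<in> J)"
    using nz unfolding koszul_nz_def by blast
  obtain F where F: "f = (\<Sum>j\<in>UNIV. F j * var j)" using max_ideal_expand[OF f] .
  have kw: "kd var (wedge F z) A = f * z A - wedge F (kd var z) A" for A
    using kd_wedge[of var F z A] unfolding F[symmetric] by (simp add: algebra_simps)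
  show ?thesis unfolding koszul_nz_def
  proof (intro exI[of _ "wedge F z"] conjI allI impI notI)
    fix A assume "wedge F z A \<noteq> 0"
    then obtain j where j: "j \<in> A" "F j \<noteq> 0" "z (A - {j}) \<noteq> 0" by (rule wedge_nonzeroE)
    then have "s \<le> card (A - {j})" by (intro z(1))
    moreover have "card A = Suc (card (A - {j}))" using card_Suc_Diff1[OF _ j(1)] by simp
    ultimately show "Suc s \<le> card A" by simp
  next
    fix A
    have "wedge F (kd var z) A \<in> J" by (rule wedge_in_ideal[OF J z(2)])
    moreover have "f * z A \<in> ?K" unfolding K by (intro exI[of _ "z A"]) (simp add: rmod.subspace_0[OF J] mult.commute)
    ultimately show "kd var (wedge F z) A \<in> ?K" unfolding kw using JK by (intro rmod.span_diff) auto
  next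
    assume "\<exists>y. \<forall>A. wedge F z A - kd var y A \<in> ?K"
    then obtain y where "\<forall>A. \<exists>k. wedge F z A - kd var y A - k * f \<in> J" unfolding K by blast
    then obtain k where k: "\<And>A. wedge F z A - kd var y A - k A * f \<in> J" by metis
    have "f * (z A - kd var k A) \<in> J" for A
    proof -
      \<comment> \<open>The multipliers \<open>k\<close> of f will bound z itself. The chain
        \<open>e\<close> lies in J; its differential turns F \<and> z into f z up to J and kills dy,
        which leaves f (z - dk) in J.\<close>
      define e where "e A = wedge F z A - kd var y A - f * k A" for A
      have "kd var e A = kd var (wedge F z) A - kd var (kd var y) A - f * kd var k A"
        unfolding e_def by (simp add: kd_diff kd_scale)
      also have "\<dots> = f * (z A - kd var k A) - wedge F (kd var z) A"
        by (simp add: kd_kd kw algebra_simps)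
      finally have "f * (z A - kd var k A) = kd var e A + wedge F (kd var z) A" by simp
      moreover have "kd var e A \<in> J"
        using k by (intro kd_in_ideal[OF J]) (simp add: e_def mult.commute)
      moreover have "wedge F (kd var z) A \<in> J" by (rule wedge_in_ideal[OF J z(2)])
      ultimately show ?thesis using rmod.subspace_add[OF J] by simp
    qed
    then have "\<forall>A. z A - kd var k A \<in> J" using reg by blast
    with nb show False by blast
  qed
qed

text \<open>A class that does not bound has a nonzero coefficient at some index set, and the size of
  that set is at most the number of variables.\<close>

lemma regular_seq_length:
  fixes I :: "('v::{finite,linorder}, 'k::comm_ring_1) mpoly set"
  assumes I: "rmod.subspace I" and nz: "koszul_nz I s" and fs: "regular_seq I fs"
  shows "s + length fs \<le> card (UNIV :: 'v set)"
proof -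
  have "koszul_nz (rmod.span (I \<union> set (take i fs))) (s + i)" if "i \<le> length fs" for i
    using that
  proof (induction i)
    case 0
    then show ?case using nz I by (simp add: rmod.span_eq_iff[THEN iffD2])
  next
    case (Suc i)
    then have i: "i < length fs" by simp
    let ?J = "rmod.span (I \<union> set (take i fs))"
    have "koszul_nz (rmod.span (insert (fs ! i) ?J)) (Suc (s + i))"
    proof (rule koszul_nz_insert)
      show "fs ! i \<in> max_ideal" using fs i by (auto simp: regular_seq_def)
      show "g \<in> ?J" if "fs ! i * g \<in> ?J" for g
        using fs i that by (auto simp: regular_seq_def ideal_gen_eq_span)
      show "koszul_nz ?J (s + i)" using Suc by simp
    qed simp
    moreover have "rmod.span (insert (fs ! i) ?J) = rmod.span (I \<union> set (take (Suc i) fs))"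
      using i by (simp add: take_Suc_conv_app_nth rmod.span_insert[of _ ?J] rmod.span_span)
        (simp add: rmod.span_insert)
    ultimately show ?case by simp
  qed
  then have "koszul_nz (rmod.span (I \<union> set (take (length fs) fs))) (s + length fs)" by blast
  then obtain z where z: "\<And>A. z A \<noteq> 0 \<Longrightarrow> s + length fs \<le> card A"
    and nb: "\<not> (\<exists>y. \<forall>A. z A - kd var y A \<in> rmod.span (I \<union> set (take (length fs) fs)))"
    unfolding koszul_nz_def by blast
  have "\<exists>A. z A \<noteq> 0"
  proof (rule ccontr)
    assume "\<not> ?thesis"
    then have "\<forall>A. z A - kd var (\<lambda>A. 0) A \<in> rmod.span (I \<union> set (take (length fs) fs))"
      by (simp add: rmod.span_zero)
    with nb show False by blast
  qed
  then obtain A where "z A \<noteq> 0" ..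
  then have "s + length fs \<le> card A" by (rule z)
  also have "card A \<le> card (UNIV :: 'v set)" by (rule card_mono) auto
  finally show ?thesis .
qed

section \<open>Monomial ideals as up-sets of exponents\<close>

definition exps :: "('v, 'k::comm_ring_1) mpoly set \<Rightarrow> ('v \<Rightarrow> nat) set" where
  "exps I = Poly_Mapping.lookup ` {a. mon a \<in> I}"

definition pm :: "('v::finite \<Rightarrow> nat) \<Rightarrow> 'v \<Rightarrow>\<^sub>0 nat" where
  "pm = Abs_poly_mapping"

lemma lookup_pm [simp]: "Poly_Mapping.lookup (pm b) = b"
  by (simp add: pm_def lookup_Abs_poly_mapping)

lemma pm_lookup [simp]: "pm (Poly_Mapping.lookup a) = a"
  by (simp add: poly_mapping_eq_iff)

lemma exps_iff: "b \<in> exps I \<longleftrightarrow> mon (pm b) \<in> I"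
  by (auto simp: exps_def image_iff)

lemma mon_add: "mon (a + b) = mon a * mon b"
  by (simp add: mon_def mult_single)

lemma monomial_ideal_subspace: "monomial_ideal I \<Longrightarrow> rmod.subspace I"
  by (auto simp: monomial_ideal_def ideal_gen_eq_span)

text \<open>The polynomials all of whose monomials lie in I form an ideal containing the generators
  of I.\<close>

lemma monomial_ideal_iff:
  fixes I :: "('v, 'k::comm_ring_1) mpoly set"
  assumes "monomial_ideal I"
  shows "f \<in> I \<longleftrightarrow> (\<forall>a\<in>Poly_Mapping.keys f. mon a \<in> I)"
proof
  obtain B where B: "I = rmod.span (mon ` B)" using assms by (auto simp: monomial_ideal_def ideal_gen_eq_span)
  let ?S = "{f :: ('v, 'k) mpoly. \<forall>a\<in>Poly_Mapping.keys f. mon a \<in> I}"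
  have "rmod.subspace ?S"
  proof (rule rmod.subspaceI)
    fix f g assume "f \<in> ?S" "g \<in> ?S"
    then show "f + g \<in> ?S" using keys_add[of f g] by blast
  next
    fix c f assume f: "f \<in> ?S"
    have "mon (a + b) \<in> I" if "b \<in> Poly_Mapping.keys f" for a b
      using f that rmod.subspace_scale[OF monomial_ideal_subspace[OF assms]] by (simp add: mon_add)
    then show "c * f \<in> ?S" using keys_mult[of c f] by blast
  qed simp
  moreover have "mon ` B \<subseteq> ?S"
    unfolding B by (auto simp: mon_def intro: rmod.span_base)
  ultimately have "I \<subseteq> ?S" unfolding B by (rule rmod.span_minimal[rotated])
  then show "f \<in> I \<Longrightarrow> \<forall>a\<in>Poly_Mapping.keys f. mon a \<in> I" by blast
next
  assume *: "\<forall>a\<in>Poly_Mapping.keys f. mon a \<in> I"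
  have "Poly_Mapping.single a (Poly_Mapping.lookup f a) \<in> I" if "a \<in> Poly_Mapping.keys f" for a
  proof -
    have "Poly_Mapping.single a (Poly_Mapping.lookup f a) = Poly_Mapping.single 0 (Poly_Mapping.lookup f a) * mon a"
      by (simp add: mon_def mult_single)
    then show ?thesis using * that rmod.subspace_scale[OF monomial_ideal_subspace[OF assms]] by simp
  qed
  then have "(\<Sum>a\<in>Poly_Mapping.keys f. Poly_Mapping.single a (Poly_Mapping.lookup f a)) \<in> I"
    by (rule rmod.subspace_sum[OF monomial_ideal_subspace[OF assms]])
  then show "f \<in> I" by (simp only: poly_sum_monomials)
qed

lemma monomial_ideal_iff_exps:
  assumes "monomial_ideal (I :: ('v::finite, 'k::comm_ring_1) mpoly set)"
  shows "f \<in> I \<longleftrightarrow> (\<forall>a\<in>Poly_Mapping.keys f. Poly_Mapping.lookup a \<in> exps I)"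
  by (subst monomial_ideal_iff[OF assms]) (simp add: exps_iff)

lemma upset_on_exps:
  fixes I :: "('v::finite, 'k::comm_ring_1) mpoly set"
  assumes "monomial_ideal I"
  shows "upset_on UNIV (exps I)"
  unfolding upset_on_def
proof (intro allI impI)
  fix a b :: "'v \<Rightarrow> nat" assume a: "a \<in> exps I" and le: "\<forall>i\<in>UNIV. a i \<le> b i"
  have "pm b = pm (\<lambda>i. b i - a i) + pm a"
    using le by (simp add: poly_mapping_eq_iff lookup_add fun_eq_iff)
  then have "mon (pm b) = (mon (pm (\<lambda>i. b i - a i)) * mon (pm a) :: ('v, 'k) mpoly)" by (simp add: mon_add)
  then show "b \<in> exps I"
    using a rmod.subspace_scale[OF monomial_ideal_subspace[OF assms]] by (simp add: exps_iff)
qed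

lemma mingen_exps:
  fixes I :: "('v::finite, 'k::comm_ring_1) mpoly set"
  shows "a \<in> mingen (exps I) \<longleftrightarrow> pm a \<in> min_gens I"
proof -
  have eq: "pm b = pm a \<longleftrightarrow> b = a" for b by (metis lookup_pm)
  have "(\<forall>b. mon b \<in> I \<and> mdvd b (pm a) \<longrightarrow> b = pm a) \<longleftrightarrow> (\<forall>b. mon (pm b) \<in> I \<and> b \<le> a \<longrightarrow> b = a)"
    by (metis (no_types, lifting) eq le_fun_def lookup_pm mdvd_def pm_lookup)
  then show ?thesis by (auto simp: mingen_def min_gens_def exps_iff)
qed

lemma wpoly_exps:
  fixes I :: "('v::{finite,linorder}, 'k::comm_ring_1) mpoly set"
  assumes "weakly_polymatroidal I"
  shows "wpoly (exps I)"
  unfolding wpoly_def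
proof (intro ballI allI impI)
  fix a b :: "'v \<Rightarrow> nat" and t
  assume a: "a \<in> mingen (exps I)" and b: "b \<in> mingen (exps I)" and t: "(\<forall>i<t. a i = b i) \<and> b t < a t"
  have "\<exists>j>t. Poly_Mapping.lookup (pm b) j > 0 \<and>
      mon (pm b + Poly_Mapping.single t 1 - Poly_Mapping.single j 1) \<in> I"
    using assms[unfolded weakly_polymatroidal_def, rule_format, of "pm a" "pm b" t] a b t
    by (simp add: mingen_exps)
  then obtain j where j: "t < j" "0 < b j" "mon (pm b + Poly_Mapping.single t 1 - Poly_Mapping.single j 1) \<in> I"
    by auto
  have "pm b + Poly_Mapping.single t 1 - Poly_Mapping.single j 1 = pm (b(t := Suc (b t), j := b j - 1))"
    using j(1) by (auto simp: poly_mapping_eq_iff fun_eq_iff lookup_add lookup_minus lookup_single when_def)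
  with j show "\<exists>j>t. 0 < b j \<and> b(t := Suc (b t), j := b j - 1) \<in> exps I"
    by (intro exI[of _ j]) (simp add: exps_iff)
qed

lemma zero_notin_exps:
  assumes "rmod.subspace I" "I \<noteq> UNIV"
  shows "(\<lambda>_. 0) \<notin> exps (I :: ('v::finite, 'k::comm_ring_1) mpoly set)"
proof
  assume "(\<lambda>_. 0) \<in> exps I"
  moreover have "pm (\<lambda>_. 0) = (0 :: 'v \<Rightarrow>\<^sub>0 nat)" by (simp add: poly_mapping_eq_iff fun_eq_iff)
  ultimately have "1 \<in> I" by (simp add: exps_iff mon_def)
  then have "f \<in> I" for f using rmod.subspace_scale[OF assms(1), of 1 f] by simp
  with assms(2) show False by auto
qed

text \<open>The degree b part of a chain over the polynomial ring, e_A having degree A. The value 0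
  for A not below b matters because \<open>lower\<close> truncates and would pick a coefficient of
  another degree.\<close>

definition coeff_part :: "('v::finite \<Rightarrow> nat) \<Rightarrow> ('v set \<Rightarrow> ('v, 'k::comm_ring_1) mpoly) \<Rightarrow> 'v set \<Rightarrow> 'k" where
  "coeff_part b y A = (if \<forall>j\<in>A. 0 < b j then Poly_Mapping.lookup (y A) (pm (lower b A)) else 0)"

lemma coeff_part_diff:
  fixes y z :: "'v::finite set \<Rightarrow> ('v, 'k::comm_ring_1) mpoly"
  shows "coeff_part b (\<lambda>A. y A - z A) A = coeff_part b y A - coeff_part b z A"
proof -
  have "(if P then p - q else 0) = (if P then p else 0) - (if P then q else 0)" for P and p q :: 'k
    by simp
  then show ?thesis by (simp only: coeff_part_def lookup_minus)
qed

definition spread :: "('v::finite \<Rightarrow> nat) \<Rightarrow> ('v set \<Rightarrow> 'k) \<Rightarrow> 'v set \<Rightarrow> ('v, 'k::comm_ring_1) mpoly" where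
  "spread b c A = Poly_Mapping.single (pm (lower b A)) (c A)"

lemma lookup_sgn_mult:
  "Poly_Mapping.lookup (sgn_ins j A * f) m = sgn_ins j A * Poly_Mapping.lookup (f :: ('v, 'k::comm_ring_1) mpoly) m"
  by (cases "even (card {k\<in>A. k < j})") (simp_all add: sgn_ins_def)

lemma lookup_var_mult:
  "Poly_Mapping.lookup (var j * f) m =
    (if 0 < Poly_Mapping.lookup m j then Poly_Mapping.lookup f (m - Poly_Mapping.single j 1) else 0)"
proof -
  have "mdvd (Poly_Mapping.single j 1) m \<longleftrightarrow> 0 < Poly_Mapping.lookup m j"
    by (auto simp: mdvd_def lookup_single when_def Suc_le_eq)
  then show ?thesis by (simp add: var_def lookup_mon_mult)
qed

lemma lookup_kd_var:
  "Poly_Mapping.lookup (kd var y A) m = (\<Sum>j\<in>-A. sgn_ins j A *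
    (if 0 < Poly_Mapping.lookup m j then Poly_Mapping.lookup (y (insert j A)) (m - Poly_Mapping.single j 1) else 0))"
  unfolding kd_def lookup_sum by (rule sum.cong) (simp_all only: mult.assoc lookup_sgn_mult lookup_var_mult)

lemma pm_lower_insert:
  assumes "j \<notin> A"
  shows "pm (lower b A) - Poly_Mapping.single j 1 = pm (lower b (insert j A))"
  using assms by (auto simp: poly_mapping_eq_iff fun_eq_iff lookup_minus lookup_single lower_def when_def)

lemma coeff_part_kd: "coeff_part b (kd var y) A = bd (coeff_part b y) A"
proof (cases "\<forall>j\<in>A. 0 < b j")
  case True
  have "(if 0 < lower b A j then Poly_Mapping.lookup (y (insert j A)) (pm (lower b A) - Poly_Mapping.single j 1) else 0)
      = 1 * coeff_part b y (insert j A)" if "j \<in> - A" for j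
  proof -
    have "lower b A j = b j" using that by (simp add: lower_def)
    then show ?thesis
      using True that pm_lower_insert[of j A b] by (simp add: coeff_part_def)
  qed
  then show ?thesis using True
    unfolding coeff_part_def[of b "kd var y" A] lookup_kd_var kd_def[of "\<lambda>_. 1"] by (simp add: mult.assoc)
next
  case False
  then have "\<not> (\<forall>i\<in>insert j A. 0 < b i)" for j by auto
  then show ?thesis using False by (simp only: coeff_part_def kd_def if_False mult_zero_right sum.neutral_const)
qed

lemma coeff_part_spread:
  assumes "\<And>A. c A \<noteq> 0 \<Longrightarrow> \<forall>j\<in>A. 0 < b j"
  shows "coeff_part b (spread b c) A = c A"
  using assms[of A] by (cases "c A = 0") (simp_all add: coeff_part_def spread_def)

lemma kd_spread:
  assumes "\<And>A. c A \<noteq> 0 \<Longrightarrow> \<forall>j\<in>A. 0 < b j"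
  shows "kd var (spread b c) A = spread b (bd c) A"
proof -
  have "var j * spread b c (insert j A) = Poly_Mapping.single (pm (lower b A)) (c (insert j A))"
    if "j \<in> - A" for j
  proof (cases "c (insert j A) = 0")
    case False
    then have "0 < b j" using assms by blast
    then have "Poly_Mapping.single j 1 + pm (lower b (insert j A)) = pm (lower b A)"
      using that by (auto simp: poly_mapping_eq_iff fun_eq_iff lookup_add lookup_single lower_def when_def)
    then show ?thesis by (simp add: spread_def var_def mon_def mult_single)
  qed (simp add: spread_def)
  then have "kd var (spread b c) A = (\<Sum>j\<in>-A. sgn_ins j A * Poly_Mapping.single (pm (lower b A)) (c (insert j A)))"
    by (simp add: kd_def mult.assoc)
  also have "\<dots> = spread b (bd c) A"
    by (rule poly_mapping_eqI)
       (simp add: spread_def kd_def lookup_sum lookup_sgn_mult lookup_single when_def)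
  finally show ?thesis .
qed

text \<open>A boundary has constant coefficient 0 at the empty set, so if 1 bounded modulo I, the
  monomial 1 would lie in I. This covers s = 0, where no degree s - 1 is there for the connecting
  map to start from.\<close>

lemma koszul_nz_zero:
  fixes I :: "('v::{finite,linorder}, 'k::comm_ring_1) mpoly set"
  assumes mI: "monomial_ideal I" and I: "I \<noteq> UNIV"
  shows "koszul_nz I 0"
  unfolding koszul_nz_def
proof (intro exI[of _ "\<lambda>A. if A = {} then 1 else 0"] conjI allI notI)
  show "kd var (\<lambda>A. if A = {} then 1 else 0) A \<in> I" for A
    by (simp add: kd_def rmod.subspace_0[OF monomial_ideal_subspace[OF mI]])
next
  assume "\<exists>y. \<forall>A. (if A = {} then 1 else 0) - kd var y A \<in> I"
  then obtain y where "(if {} = ({} :: 'v set) then 1 else 0) - kd var y {} \<in> I" by blast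
  then have y: "1 - kd var y {} \<in> I" by simp
  have "Poly_Mapping.lookup (1 - kd var y {}) 0 = 1"
    by (simp add: lookup_minus lookup_kd_var)
  then have "0 \<in> Poly_Mapping.keys (1 - kd var y {})" by (simp add: in_keys_iff)
  then have "Poly_Mapping.lookup 0 \<in> exps I" using y monomial_ideal_iff_exps[OF mI] by blast
  moreover have "Poly_Mapping.lookup 0 = (\<lambda>_ :: 'v. 0 :: nat)" by (simp add: fun_eq_iff)
  ultimately show False using zero_notin_exps[OF monomial_ideal_subspace[OF mI] I] by simp
qed simp

text \<open>The connecting map from the homology of I to that of S/I: since the degree is nonzero, a
  cycle of I bounds over S, by wedging with a variable of positive exponent.\<close>

lemma koszul_nz_Suc:
  fixes I :: "('v::{finite,linorder}, 'k::comm_ring_1) mpoly set"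
  assumes mI: "monomial_ideal I" and I: "I \<noteq> UNIV"
    and na: "\<not> acyclic_from TYPE('k) (exps I) UNIV s"
  shows "koszul_nz I (Suc s)"
proof -
  note sI = monomial_ideal_subspace[OF mI] and up = upset_on_exps[OF mI]
  obtain b and c :: "'v set \<Rightarrow> 'k" where c: "c \<in> chains (exps I) UNIV b s" and cyc: "\<And>A. bd c A = 0"
    and nb: "\<And>w. w \<in> chains (exps I) UNIV b 0 \<Longrightarrow> \<exists>A. bd w A \<noteq> c A"
    using na unfolding acyclic_from_def by blast
  have cb: "c A \<noteq> 0 \<Longrightarrow> \<forall>j\<in>A. 0 < b j" for A using c by (auto simp: chains_def)
  obtain A0 where "c A0 \<noteq> 0" using nb[OF chains_zero] by auto
  then have "lower b A0 \<in> exps I" using c by (auto simp: chains_def)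
  then have "b \<in> exps I" by (rule upset_onD[OF up]) (simp add: lower_def)
  then have "b \<noteq> (\<lambda>_. 0)" using zero_notin_exps[OF sI I] by auto
  then obtain i where i: "0 < b i" by (auto simp: fun_eq_iff)
  \<comment> \<open>With all weights 1, \<open>kd_wedge\<close> shows that wedging the cycle c with
    the basis vector \<open>e\<close> gives a chain with boundary c; positivity of b i keeps it in
    degree b.\<close>
  define e :: "'v \<Rightarrow> 'k" where "e j = (if j = i then 1 else 0)" for j
  define z where "z = wedge e c"
  have bz: "bd z A = c A" for A
    using kd_wedge[of "\<lambda>_. 1" e c A] by (simp add: z_def e_def wedge_def cyc)
  have zc: "\<exists>j\<in>A. j = i \<and> c (A - {j}) \<noteq> 0" if "z A \<noteq> 0" for A
    using that unfolding z_def by (rule wedge_nonzeroE) (auto simp: e_def split: if_splits)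
  have zb: "\<forall>j\<in>A. 0 < b j" if "z A \<noteq> 0" for A
    using zc[OF that] cb i by blast
  show ?thesis unfolding koszul_nz_def
  proof (intro exI[of _ "spread b z"] conjI allI impI notI)
    fix A assume "spread b z A \<noteq> 0"
    then have "z A \<noteq> 0" by (auto simp: spread_def)
    then obtain j where j: "j \<in> A" "c (A - {j}) \<noteq> 0" using zc by blast
    then have "s \<le> card (A - {j})" using c by (auto simp: chains_def)
    then show "Suc s \<le> card A" using card_Suc_Diff1[OF _ j(1)] by simp
  next
    fix A
    have "kd var (spread b z) A = Poly_Mapping.single (pm (lower b A)) (c A)"
      using kd_spread[of z b A] zb bz by (simp add: spread_def)
    moreover have "c A \<noteq> 0 \<Longrightarrow> lower b A \<in> exps I" using c by (auto simp: chains_def)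
    ultimately show "kd var (spread b z) A \<in> I" by (auto simp: monomial_ideal_iff_exps[OF mI])
  next
    assume "\<exists>y. \<forall>A. spread b z A - kd var y A \<in> I"
    then obtain y where y: "\<And>A. spread b z A - kd var y A \<in> I" by blast
    \<comment> \<open>The degree b part of the difference is a chain of I and still has boundary c,
      which \<open>nb\<close> excludes.\<close>
    define w where "w = coeff_part b (\<lambda>A. spread b z A - kd var y A)"
    have "w A = z A - bd (coeff_part b y) A" for A
    proof -
      have "w A = coeff_part b (spread b z) A - coeff_part b (kd var y) A"
        by (simp only: w_def coeff_part_diff)
      then show ?thesis by (simp add: coeff_part_spread[OF zb] coeff_part_kd)
    qed
    then have "w = (\<lambda>A. z A - bd (coeff_part b y) A)" by auto
    then have "bd w A = c A" for A by (simp add: kd_diff kd_kd bz)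
    moreover have "w \<in> chains (exps I) UNIV b 0"
      unfolding chains_def
    proof (intro CollectI allI impI)
      fix A assume "w A \<noteq> 0"
      then have bA: "\<forall>j\<in>A. 0 < b j" and "pm (lower b A) \<in> Poly_Mapping.keys (spread b z A - kd var y A)"
        by (auto simp: w_def coeff_part_def in_keys_iff split: if_splits)
      then have "lower b A \<in> exps I" using y[of A] monomial_ideal_iff_exps[OF mI] by fastforce
      with bA show "A \<subseteq> UNIV \<and> 0 \<le> card A \<and> (\<forall>j\<in>A. 0 < b j) \<and> lower b A \<in> exps I" by simp
    qed
    ultimately show False using nb by blast
  qed
qed

section \<open>Stanley decompositions from cones\<close>

lemma poly_in_iff: "f \<in> poly_in Z \<longleftrightarrow> (\<forall>a. Poly_Mapping.lookup f a \<noteq> 0 \<longrightarrow> Poly_Mapping.keys a \<subseteq> Z)"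
  by (auto simp: poly_in_def in_keys_iff)

lemma lookup_mon_mult_outside:
  fixes a :: "'v::finite \<Rightarrow> nat"
  assumes "f \<in> poly_in Z" "Poly_Mapping.lookup x \<notin> cone a Z"
  shows "Poly_Mapping.lookup (mon (pm a) * f) x = 0"
proof (cases "mdvd (pm a) x \<and> Poly_Mapping.lookup f (x - pm a) \<noteq> 0")
  case True
  then have "Poly_Mapping.keys (x - pm a) \<subseteq> Z" using assms(1) by (simp add: poly_in_iff)
  then have "Poly_Mapping.lookup x i - a i = 0" if "i \<notin> Z" for i
    using that by (auto simp: in_keys_iff lookup_minus)
  then have "Poly_Mapping.lookup x \<in> cone a Z" using True by (auto simp: cone_def mdvd_def intro!: antisym)
  with assms(2) show ?thesis by simp
qed (auto simp: lookup_mon_mult)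

text \<open>The terms of g in the cone are divisible by x^a with quotients in the variables of Z; f
  is the sum of these quotients.\<close>

lemma poly_in_restrict:
  fixes g :: "('v::finite, 'k::comm_ring_1) mpoly"
  obtains f where "f \<in> poly_in Z"
    and "\<And>x. Poly_Mapping.lookup x \<in> cone a Z \<Longrightarrow> Poly_Mapping.lookup (mon (pm a) * f) x = Poly_Mapping.lookup g x"
proof -
  define K where "K = {x \<in> Poly_Mapping.keys g. Poly_Mapping.lookup x \<in> cone a Z}"
  define f where "f = (\<Sum>x\<in>K. Poly_Mapping.single (x - pm a) (Poly_Mapping.lookup g x))"
  have "f \<in> poly_in Z"
    unfolding poly_in_iff
  proof (intro allI impI)
    fix y assume "Poly_Mapping.lookup f y \<noteq> 0"
    then have "(\<Sum>x\<in>K. Poly_Mapping.lookup (Poly_Mapping.single (x - pm a) (Poly_Mapping.lookup g x)) y) \<noteq> 0"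
      by (simp add: f_def lookup_sum)
    then obtain x where x: "x \<in> K" "Poly_Mapping.lookup (Poly_Mapping.single (x - pm a) (Poly_Mapping.lookup g x)) y \<noteq> 0"
      by (rule sum.not_neutral_contains_not_neutral)
    then have "y = x - pm a" by (simp add: lookup_single when_def split: if_splits)
    then show "Poly_Mapping.keys y \<subseteq> Z"
      using x(1) by (auto simp: K_def cone_def in_keys_iff lookup_minus)
  qed
  moreover have "Poly_Mapping.lookup (mon (pm a) * f) x = Poly_Mapping.lookup g x"
    if x: "Poly_Mapping.lookup x \<in> cone a Z" for x
  proof -
    have "pm a + (y - pm a) = y" if "y \<in> K" for y
      using that by (auto simp: K_def cone_def poly_mapping_eq_iff fun_eq_iff lookup_add lookup_minus)
    then have "mon (pm a) * f = (\<Sum>y\<in>K. Poly_Mapping.single y (Poly_Mapping.lookup g y))"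
      by (simp add: f_def mon_def sum_distrib_left mult_single)
    then have "Poly_Mapping.lookup (mon (pm a) * f) x = (\<Sum>y\<in>K. if y = x then Poly_Mapping.lookup g y else 0)"
      by (simp add: lookup_sum lookup_single when_def)
    also have "\<dots> = Poly_Mapping.lookup g x"
      using x by (auto simp: K_def sum.delta in_keys_iff)
    finally show ?thesis .
  qed
  ultimately show thesis by (rule that)
qed

lemma stanley_decomp_of_cones:
  fixes I :: "('v::finite, 'k::comm_ring_1) mpoly set"
  assumes mI: "monomial_ideal I" and D: "cone_partition D (std UNIV (exps I))"
  obtains L where "stanley_decomp I L" "snd ` set L = snd ` D"
proof -
  have "finite D" using D by (simp add: cone_partition_def)
  then obtain l where l: "set l = D" "distinct l" using finite_distinct_list by blast
  define L where "L = map (\<lambda>p. (mon (pm (fst p)) :: ('v, 'k) mpoly, snd p)) l"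
  have len: "length L = length l" by (simp add: L_def)
  have Li: "fst (L ! i) = mon (pm (fst (l ! i)))" "snd (L ! i) = snd (l ! i)" if "i < length l" for i
    using that by (simp_all add: L_def)
  have out: "x \<notin> exps I" if "p \<in> D" "x \<in> cone (fst p) (snd p)" for p x
  proof -
    have "cone (fst p) (snd p) \<subseteq> std UNIV (exps I)" using D that(1) unfolding cone_partition_def case_prod_beta by blast
    then show ?thesis using that(2) by (auto simp: std_def)
  qed
  have ex: "\<exists>i<length l. x \<in> cone (fst (l ! i)) (snd (l ! i))" if "x \<notin> exps I" for x
  proof -
    have "x \<in> std UNIV (exps I)" using that by (simp add: std_def)
    then obtain p where "p \<in> D" "x \<in> cone (fst p) (snd p)" using D unfolding cone_partition_def by blast
    then show ?thesis using l(1) by (metis in_set_conv_nth)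
  qed
  have uniq: "i = j"
    if "i < length l" "j < length l" "x \<in> cone (fst (l ! i)) (snd (l ! i))" "x \<in> cone (fst (l ! j)) (snd (l ! j))" for i j x
  proof -
    have D': "l ! i \<in> D" "l ! j \<in> D" using that(1,2) l(1) by auto
    have "x \<in> std UNIV (exps I)" using out[OF D'(1) that(3)] by (simp add: std_def)
    then have "l ! i = l ! j" using D D' that(3,4) unfolding cone_partition_def by blast
    then show ?thesis using l(2) that(1,2) by (simp add: nth_eq_iff_index_eq)
  qed
  \<comment> \<open>The cones are disjoint, so a coefficient of the total inside a cone comes from
    the summand of that cone alone. This yields both generation and directness.\<close>
  have lookup_total: "Poly_Mapping.lookup (\<Sum>j<length L. fst (L ! j) * fs ! j) x
      = Poly_Mapping.lookup (fst (L ! i) * fs ! i) x"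
    if fs: "\<forall>i<length L. fs ! i \<in> poly_in (snd (L ! i))" and i: "i < length l"
      and x: "Poly_Mapping.lookup x \<in> cone (fst (l ! i)) (snd (l ! i))" for fs i x
  proof -
    have "Poly_Mapping.lookup (fst (L ! j) * fs ! j) x = 0" if j: "j \<in> {..<length L} - {i}" for j
    proof -
      have jl: "j < length l" "j \<noteq> i" using j len by auto
      then have "Poly_Mapping.lookup x \<notin> cone (fst (l ! j)) (snd (l ! j))" using uniq[OF i jl(1) x] by auto
      moreover have "fs ! j \<in> poly_in (snd (l ! j))" using fs jl(1) Li(2) len by metis
      ultimately show ?thesis using lookup_mon_mult_outside Li(1)[OF jl(1)] by metis
    qed
    then have "(\<Sum>j\<in>{..<length L} - {i}. Poly_Mapping.lookup (fst (L ! j) * fs ! j) x) = 0"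
      by (rule sum.neutral[OF ballI])
    then show ?thesis
      unfolding lookup_sum using i len
      by (subst sum.remove[of _ i]) auto
  qed
  have "stanley_decomp I L"
    unfolding stanley_decomp_def
  proof (intro conjI)
    show "\<forall>(u, Z)\<in>set L. stanley_space I u Z"
    proof (clarify)
      fix u Z assume "(u, Z) \<in> set L"
      then obtain p where p: "p \<in> D" "u = mon (pm (fst p))" "Z = snd p" using l(1) by (auto simp: L_def)
      have "f = 0" if f: "f \<in> poly_in Z" and uf: "u * f \<in> I" for f
      proof (rule poly_mapping_eqI, rule ccontr)
        fix y assume nz: "Poly_Mapping.lookup f y \<noteq> Poly_Mapping.lookup 0 y"
        have "mdvd (pm (fst p)) (pm (fst p) + y)" "pm (fst p) + y - pm (fst p) = y"
          by (auto simp: mdvd_def lookup_add)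
        then have "Poly_Mapping.lookup (u * f) (pm (fst p) + y) \<noteq> 0"
          using nz by (simp add: p(2) lookup_mon_mult)
        then have "pm (fst p) + y \<in> Poly_Mapping.keys (u * f)"
          and "Poly_Mapping.lookup (pm (fst p) + y) \<in> cone (fst p) (snd p)"
          using lookup_mon_mult_outside[OF f] p by (auto simp: in_keys_iff)
        then show False using out[OF p(1)] uf monomial_ideal_iff_exps[OF mI] by blast
      qed
      then show "stanley_space I u Z"
        by (auto simp: stanley_space_def is_term_def p(2) mon_def)
    qed
  next
    show "\<forall>g. \<exists>fs. length fs = length L \<and> (\<forall>i<length L. fs ! i \<in> poly_in (snd (L ! i))) \<and>
        g - (\<Sum>i<length L. fst (L ! i) * fs ! i) \<in> I"
    proof
      fix g :: "('v, 'k) mpoly"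
      have "\<exists>f. f \<in> poly_in (snd (l ! i)) \<and> (\<forall>x. Poly_Mapping.lookup x \<in> cone (fst (l ! i)) (snd (l ! i)) \<longrightarrow>
          Poly_Mapping.lookup (mon (pm (fst (l ! i))) * f) x = Poly_Mapping.lookup g x)" for i
        by (rule poly_in_restrict) blast
      then obtain F where F: "\<And>i. F i \<in> poly_in (snd (l ! i))"
        "\<And>i x. Poly_Mapping.lookup x \<in> cone (fst (l ! i)) (snd (l ! i)) \<Longrightarrow>
          Poly_Mapping.lookup (mon (pm (fst (l ! i))) * F i) x = Poly_Mapping.lookup g x"
        by metis
      define fs where "fs = map F [0..<length L]"
      have fs: "length fs = length L" "\<forall>i<length L. fs ! i \<in> poly_in (snd (L ! i))"
        using F(1) Li(2) len by (auto simp: fs_def)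
      have "g - (\<Sum>i<length L. fst (L ! i) * fs ! i) \<in> I"
        unfolding monomial_ideal_iff_exps[OF mI]
      proof (rule ballI, rule ccontr)
        fix x assume x: "x \<in> Poly_Mapping.keys (g - (\<Sum>i<length L. fst (L ! i) * fs ! i))"
          and "Poly_Mapping.lookup x \<notin> exps I"
        then obtain i where i: "i < length l" "Poly_Mapping.lookup x \<in> cone (fst (l ! i)) (snd (l ! i))"
          using ex by blast
        have "fs ! i = F i" using i(1) len by (simp add: fs_def)
        then have "Poly_Mapping.lookup (fst (L ! i) * fs ! i) x = Poly_Mapping.lookup g x"
          using F(2)[OF i(2)] Li(1)[OF i(1)] by simp
        then show False using x lookup_total[OF fs(2) i] by (simp add: in_keys_iff lookup_minus)
      qed
      with fs show "\<exists>fs. length fs = length L \<and> (\<forall>i<length L. fs ! i \<in> poly_in (snd (L ! i))) \<and>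
        g - (\<Sum>i<length L. fst (L ! i) * fs ! i) \<in> I" by blast
    qed
  next
    show "\<forall>fs. length fs = length L \<and> (\<forall>i<length L. fs ! i \<in> poly_in (snd (L ! i))) \<and>
        (\<Sum>i<length L. fst (L ! i) * fs ! i) \<in> I \<longrightarrow> (\<forall>i<length L. fst (L ! i) * fs ! i \<in> I)"
    proof (intro allI impI, elim conjE)
      fix fs i assume fs: "\<forall>i<length L. fs ! i \<in> poly_in (snd (L ! i))"
        and sI: "(\<Sum>i<length L. fst (L ! i) * fs ! i) \<in> I" and i: "i < length L"
      have il: "i < length l" using i len by simp
      have fi: "fs ! i \<in> poly_in (snd (l ! i))" using fs i Li(2)[OF il] by metis
      show "fst (L ! i) * fs ! i \<in> I"
        unfolding monomial_ideal_iff_exps[OF mI]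
      proof
        fix x assume x: "x \<in> Poly_Mapping.keys (fst (L ! i) * fs ! i)"
        then have xc: "Poly_Mapping.lookup x \<in> cone (fst (l ! i)) (snd (l ! i))"
          using lookup_mon_mult_outside[OF fi] Li(1)[OF il] by (metis in_keys_iff)
        then have "x \<in> Poly_Mapping.keys (\<Sum>i<length L. fst (L ! i) * fs ! i)"
          using x lookup_total[OF fs il] by (simp add: in_keys_iff)
        then show "Poly_Mapping.lookup x \<in> exps I" using sI monomial_ideal_iff_exps[OF mI] by blast
      qed
    qed
  qed
  moreover have "snd ` set L = snd ` D" using l(1) by (force simp: L_def image_iff)
  ultimately show thesis by (rule that)
qed

text \<open>Keeps the minimum in \<open>stanley_depth_of\<close> away from the empty set: an empty
  sum can only represent zero in S/I.\<close>

lemma stanley_decomp_nonempty: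
  assumes "stanley_decomp I L" "I \<noteq> UNIV"
  shows "L \<noteq> []"
proof
  assume "L = []"
  then have "g \<in> I" for g using assms(1) unfolding stanley_decomp_def by (auto dest: spec[of _ g])
  with assms(2) show False by auto
qed

lemma stanley_depth_of_le_card:
  fixes L :: "(('v::finite, 'k::comm_ring_1) mpoly \<times> 'v set) list"
  assumes "L \<noteq> []"
  shows "stanley_depth_of L \<le> card (UNIV :: 'v set)"
proof -
  obtain u Z where p: "(u, Z) \<in> set L" using assms by (cases L) auto
  have "stanley_depth_of L \<le> card Z"
    unfolding stanley_depth_of_def by (rule Min_le) (use p in \<open>force+\<close>)
  also have "\<dots> \<le> card (UNIV :: 'v set)" by (rule card_mono) auto
  finally show ?thesis .
qed

text \<open>The supremum in \<open>nat\<close> dominates its members because the set is bounded: no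
  Stanley space has dimension above n.\<close>

lemma stanley_depth_of_le_sdepth:
  fixes I :: "('v::finite, 'k::comm_ring_1) mpoly set"
  assumes "stanley_decomp I L" "I \<noteq> UNIV"
  shows "stanley_depth_of L \<le> sdepth_quot I"
  unfolding sdepth_quot_def
proof (rule cSup_upper)
  show "stanley_depth_of L \<in> {stanley_depth_of D |D. stanley_decomp I D}" using assms(1) by blast
  show "bdd_above {stanley_depth_of D |D. stanley_decomp I D}"
    using stanley_depth_of_le_card[OF stanley_decomp_nonempty[OF _ assms(2)]]
    by (intro bdd_aboveI[of _ "card (UNIV :: 'v set)"]) blast
qed

theorem theorem2p3:
  fixes I :: "('v::{finite, linorder}, 'k::field) mpoly set"
  assumes "monomial_ideal I"
    and "I \<noteq> UNIV"
    and "weakly_polymatroidal I"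
  shows "depth_quot I \<le> sdepth_quot I"
proof -
  let ?n = "card (UNIV :: 'v set)" and ?U = "exps I"
  let ?acyc = "acyclic_from TYPE('k) ?U UNIV"
  note sI = monomial_ideal_subspace[OF assms(1)]
  \<comment> \<open>No index set has more than n elements, so vanishing from n + 1 on is automatic
    and a least s exists.\<close>
  have "?acyc (Suc ?n)"
    unfolding acyclic_from_def
  proof (intro allI ballI impI)
    fix b and c :: "'v set \<Rightarrow> 'k" assume "c \<in> chains ?U UNIV b (Suc ?n)"
    then have "Suc ?n \<le> card A" if "c A \<noteq> 0" for A using that by (auto simp: chains_def)
    moreover have "card A \<le> ?n" for A :: "'v set" by (rule card_mono) auto
    ultimately have "c A = 0" for A using not_less_eq_eq by blast
    then show "\<exists>w\<in>chains ?U UNIV b 0. \<forall>A. bd w A = c A"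
      by (intro bexI[of _ "\<lambda>A. 0"]) auto
  qed
  then obtain s where s: "?acyc s" "\<And>r. r < s \<Longrightarrow> \<not> ?acyc r"
    using exists_least_iff[of ?acyc] by blast
  \<comment> \<open>For s > 0, vanishing from s - 1 on fails by minimality, and the connecting map
    carries this failure to S/I in degree s.\<close>
  have nz: "koszul_nz I s"
  proof (cases s)
    case 0
    then show ?thesis using koszul_nz_zero[OF assms(1,2)] by simp
  next
    case (Suc r)
    then show ?thesis using koszul_nz_Suc[OF assms(1,2)] s(2) by blast
  qed
  obtain D where D: "cone_partition D (std UNIV ?U)" and cD: "\<forall>(a,Z)\<in>D. ?n \<le> card Z + s"
    using cone_partition_exists[OF upset_on_exps[OF assms(1)] wpoly_exps[OF assms(3)] s(1)] by blast
  obtain L where L: "stanley_decomp I L" "snd ` set L = snd ` D"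
    by (rule stanley_decomp_of_cones[OF assms(1) D])
  have "L \<noteq> []" by (rule stanley_decomp_nonempty[OF L(1) assms(2)])
  have "?n \<le> card Z + s" if "(u, Z) \<in> set L" for u Z
  proof -
    have "Z \<in> snd ` D" using that L(2) by force
    then show ?thesis using cD by auto
  qed
  then have "?n - s \<le> stanley_depth_of L"
    unfolding stanley_depth_of_def using \<open>L \<noteq> []\<close> by (subst Min_ge_iff) (auto simp: diff_le_eq le_diff_conv)
  also have "\<dots> \<le> sdepth_quot I" by (rule stanley_depth_of_le_sdepth[OF L(1) assms(2)])
  finally have sd: "?n - s \<le> sdepth_quot I" .
  show ?thesis
    unfolding depth_quot_def
  proof (rule cSup_least)
    have "ideal_gen I = I" by (simp only: ideal_gen_eq_span rmod.span_eq_iff[THEN iffD2, OF sI])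
    moreover have "1 \<notin> I" using rmod.subspace_scale[OF sI, of 1] assms(2) by auto
    ultimately have "regular_seq I []" by (simp add: regular_seq_def)
    then show "{length fs |fs. regular_seq I fs} \<noteq> {}" by blast
  next
    fix m assume "m \<in> {length fs |fs. regular_seq I fs}"
    then have "s + m \<le> ?n" using regular_seq_length[OF sI nz] by auto
    with sd show "m \<le> sdepth_quot I" by simp
  qed
qed

end
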